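(* For all integers $k\ge 3$, \[k^2+k-2 \le p(Q_{2k} \setminus v) \le k^2+k -1.\] For all integers $k \ge 4$, \[k^2+k-2 \le p(Q_{2k} \setminus e) \le k^2+k.\]
   Context: For $n\ge 1$, $Q_n$ is the $n$-dimensional hypercube: the graph with vertex set $\{0,1\}^n$ and edges between vertices differing in exactly one coordinate. $Q_d\setminus v$ (respectively $Q_d\setminus e$) denotes the graph obtained from $Q_d$ by deleting one vertex together with its incident edges (respectively one edge); by symmetry it does not depend, up to isomorphism, on the choice. An embedding of a graph $G$ in $Q_n$ is any subgraph of $Q_n$ isomorphic to $G$. Given a set of $r$ colors, a $G$-polychromatic $r$-coloring of $Q_n$ is an assignment of one of the $r$ colors to each edge of $Q_n$ such that every embedding of $G$ in $Q_n$ contains an edge of every one of the $r$ colors. The polychromatic number $p(G)$ is the largest integer $r$ such that for every $n$ for which $Q_n$ contains an embedding of $G$, there is a $G$-polychromatic $r$-coloring of $Q_n$. *)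

theory Defs
  imports Main
begin

record 'a ugraph =
  verts :: "'a set"
  edges :: "'a set set"

definition simple_graph :: "'a ugraph \<Rightarrow> bool" where
  "simple_graph G \<longleftrightarrow> (\<forall>e\<in>edges G. e \<subseteq> verts G \<and> card e = 2)"

definition subgraph :: "'a ugraph \<Rightarrow> 'a ugraph \<Rightarrow> bool" where
  "subgraph H G \<longleftrightarrow> simple_graph H \<and> verts H \<subseteq> verts G \<and> edges H \<subseteq> edges G"

definition isomorphic :: "'a ugraph \<Rightarrow> 'b ugraph \<Rightarrow> bool" where
  "isomorphic G H \<longleftrightarrow>
     (\<exists>f. bij_betw f (verts G) (verts H) \<and>
          (\<forall>x\<in>verts G. \<forall>y\<in>verts G. {x, y} \<in> edges G \<longleftrightarrow> {f x, f y} \<in> edges H))"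

definition delete_vertex :: "'a ugraph \<Rightarrow> 'a \<Rightarrow> 'a ugraph" where
  "delete_vertex G v = \<lparr>verts = verts G - {v}, edges = {e \<in> edges G. v \<notin> e}\<rparr>"

definition delete_edge :: "'a ugraph \<Rightarrow> 'a set \<Rightarrow> 'a ugraph" where
  "delete_edge G e = \<lparr>verts = verts G, edges = edges G - {e}\<rparr>"

definition hypercube :: "nat \<Rightarrow> bool list ugraph" where
  "hypercube n =
     \<lparr>verts = {x. length x = n},
      edges = {{x, y} | x y. length x = n \<and> length y = n \<and> card {i. i < n \<and> x ! i \<noteq> y ! i} = 1}\<rparr>"

definition embedding :: "'a ugraph \<Rightarrow> nat \<Rightarrow> bool list ugraph \<Rightarrow> bool" where
  "embedding G n H \<longleftrightarrow> subgraph H (hypercube n) \<and> isomorphic G H"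

text \<open>The set of \<open>r\<close> colors is taken to be \<open>{..<r}\<close>.\<close>

definition polychromatic_coloring ::
  "'a ugraph \<Rightarrow> nat \<Rightarrow> nat \<Rightarrow> (bool list set \<Rightarrow> nat) \<Rightarrow> bool" where
  "polychromatic_coloring G r n c \<longleftrightarrow>
     (\<forall>e\<in>edges (hypercube n). c e < r) \<and>
     (\<forall>H. embedding G n H \<longrightarrow> (\<forall>i<r. \<exists>e\<in>edges H. c e = i))"

text \<open>
  The maximum below exists whenever \<open>G\<close> has finitely many edges, at least one of them, and
  embeds in some hypercube: then \<open>r\<close> is at most the number of edges of \<open>G\<close>, and \<open>r = 1\<close> is
  always admissible.
\<close>

definition polychromatic_number :: "'a ugraph \<Rightarrow> nat" where
  "polychromatic_number G =
     (GREATEST r. \<forall>n\<ge>1. (\<exists>H. embedding G n H) \<longrightarrow> (\<exists>c. polychromatic_coloring G r n c))"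

end

theory Submission imports Defs "HOL-Library.Ramsey" begin

text \<open>
  Call the number of stars to the left of a star its position.  In a subcube of dimension \<open>d = 2 * k\<close> the edges
  in the direction of a star at position \<open>j\<close> have \<open>x\<close> free ones to the left and \<open>y\<close> free ones to the right,
  where \<open>(x, y)\<close> ranges over the rectangle \<open>x \<le> j\<close>, \<open>y \<le> d - 1 - j\<close>.  Deleting a vertex
  removes at most one corner from each rectangle.

  Lower bound: if an edge has \<open>u\<close> ones in total, \<open>a\<close> of them left of its direction, colour it by
  \<open>u mod (k - 1)\<close> and \<open>(a + u div (k - 1)) mod (k + 2)\<close>.  The star at position \<open>k\<close> sees every colour unless the
  deleted vertex is all zeros on one side and all ones on the other side of it; then the star at position \<open>k - 1\<close>
  sees the missing colour.

  Upper bound: by Ramsey's theorem the colour may be assumed to depend only on \<open>(u, a)\<close>.  Fix the number \<open>L\<close> of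
  fixed ones.  For a given colour, a greedy choice of stars shows that there is a nondecreasing function \<open>J\<close> such
  that the star at position \<open>J x\<close> preceded by \<open>x\<close> fixed ones sees the colour.  By monotonicity, a cell with
  \<open>L + i\<close> ones serves at most \<open>min (i + 1, d - i, k)\<close> values of \<open>x\<close>, and these numbers add up to
  \<open>k\<^sup>2 + k\<close>; if the bottom vertex of the subcube is the deleted one, the cells with \<open>i = 0\<close> are lost.
\<close>


subsection \<open>Ramsey's theorem for all small sizes simultaneously\<close>

lemma finite_ramsey_multicolour:
  assumes "finite C"
  shows "\<exists>N. \<forall>f. (\<forall>Z\<in>nsets {..<N} t. f Z \<in> C) \<longrightarrow>
           (\<exists>H\<in>nsets {..<N::nat} m. \<exists>c. \<forall>Z\<in>nsets H t. f Z = c)"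
proof -
  obtain h :: "'a \<Rightarrow> nat" where h: "bij_betw h C {0..<card C}"
    using assms ex_bij_betw_finite_nat by blast
  obtain N where N: "partn_lst {..<N::nat} (replicate (card C) m) t"
    using ramsey_full by blast
  have "\<exists>H\<in>nsets {..<N} m. \<exists>c. \<forall>Z\<in>nsets H t. f Z = c"
    if f: "\<forall>Z\<in>nsets {..<N} t. f Z \<in> C" for f
  proof -
    have "h \<circ> f \<in> nsets {..<N} t \<rightarrow> {..<card C}"
      using f h by (auto simp: bij_betw_def)
    then obtain i H where H: "H \<in> nsets {..<N} m" "i < card C" "(h \<circ> f) ` nsets H t \<subseteq> {i}"
      using N by (elim partn_lstE) auto
    have "f Z = inv_into C h i" if "Z \<in> nsets H t" for Z
    proof -
      have "Z \<in> nsets {..<N} t"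
        using that H(1) by (auto simp: nsets_def)
      then have "f Z \<in> C"
        using f by blast
      moreover have "h (f Z) = i"
        using H(3) that by auto
      ultimately show ?thesis
        using h by (metis bij_betw_inv_into_left)
    qed
    then show ?thesis
      using H(1) by blast
  qed
  then show ?thesis
    by blast
qed

text \<open>Induction on \<open>b\<close>: inside a set homogeneous for all sizes below
  \<open>b\<close>, Ramsey's theorem for size \<open>b\<close> finds a smaller set, and passing to a
  subset keeps the homogeneity already gained.\<close>

lemma ramsey_all_sizes:
  assumes "finite C"
  shows "\<exists>N. \<forall>f. (\<forall>Z\<subseteq>{..<N}. f Z \<in> C) \<longrightarrow>
           (\<exists>H\<subseteq>{..<N::nat}. card H = m \<and>
             (\<forall>Z Z'. Z \<subseteq> H \<and> Z' \<subseteq> H \<and> card Z = card Z' \<and> card Z < b \<longrightarrow> f Z = f Z'))"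
proof (induction b arbitrary: m)
  case 0
  show ?case
    by (rule exI[of _ m]) (auto intro!: exI[of _ "{..<m}"])
next
  case (Suc b)
  \<comment> \<open>The sizes are fixed backwards: \<open>N0\<close> is what the last Ramsey step
    needs to end with \<open>m\<close> points, and the induction hypothesis is then asked for
    \<open>N0\<close> points.\<close>
  obtain N0 where N0: "\<And>f. \<forall>Z\<in>nsets {..<N0} b. f Z \<in> C \<Longrightarrow>
      \<exists>H\<in>nsets {..<N0::nat} m. \<exists>c. \<forall>Z\<in>nsets H b. f Z = c"
    using finite_ramsey_multicolour[OF assms] by metis
  obtain N where N: "\<And>f. \<forall>Z\<subseteq>{..<N}. f Z \<in> C \<Longrightarrow> \<exists>H\<subseteq>{..<N::nat}. card H = N0 \<and>
             (\<forall>Z Z'. Z \<subseteq> H \<and> Z' \<subseteq> H \<and> card Z = card Z' \<and> card Z < b \<longrightarrow> f Z = f Z')"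
    using Suc.IH[of N0] by metis
  have "\<exists>H\<subseteq>{..<N}. card H = m \<and>
         (\<forall>Z Z'. Z \<subseteq> H \<and> Z' \<subseteq> H \<and> card Z = card Z' \<and> card Z < Suc b \<longrightarrow> f Z = f Z')"
    if f: "\<forall>Z\<subseteq>{..<N}. f Z \<in> C" for f
  proof -
    obtain H where H: "H \<subseteq> {..<N}" "card H = N0"
      and fH: "\<And>Z Z'. \<lbrakk>Z \<subseteq> H; Z' \<subseteq> H; card Z = card Z'; card Z < b\<rbrakk> \<Longrightarrow> f Z = f Z'"
      using N[OF f] by blast
    have finH: "finite H"
      using H(1) finite_subset by blast
    obtain g where g: "bij_betw g {..<N0} H"
      using ex_bij_betw_nat_finite[OF finH] H(2) by (auto simp: atLeast0LessThan)
    have "\<forall>Z\<in>nsets {..<N0} b. f (g ` Z) \<in> C"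
    proof
      fix Z assume "Z \<in> nsets {..<N0} b"
      then have "g ` Z \<subseteq> H"
        using g by (auto simp: nsets_def bij_betw_def)
      then show "f (g ` Z) \<in> C"
        using f H(1) by (meson order_trans)
    qed
    then obtain K c where K: "K \<in> nsets {..<N0} m"
      and c: "\<And>Z. Z \<in> nsets K b \<Longrightarrow> f (g ` Z) = c"
      using N0[of "\<lambda>Z. f (g ` Z)"] by blast
    have KN: "K \<subseteq> {..<N0}" "finite K" "card K = m"
      using K by (auto simp: nsets_def)
    have inj: "inj_on g K"
      using g KN(1) by (auto simp: bij_betw_def intro: inj_on_subset)
    have sub: "g ` K \<subseteq> H"
      using g KN(1) by (auto simp: bij_betw_def)
    have const: "f Z = c" if Z: "Z \<subseteq> g ` K" "card Z = b" for Z
    proof -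
      obtain Z0 where Z0: "Z0 \<subseteq> K" "Z = g ` Z0"
        using Z(1) by (meson subset_imageE)
      have "card Z0 = b"
        using Z(2) Z0 inj by (metis card_image inj_on_subset)
      then show ?thesis
        using c[of Z0] Z0 KN(2) by (auto simp: nsets_def intro: finite_subset)
    qed
    have "f Z = f Z'" if "Z \<subseteq> g ` K" "Z' \<subseteq> g ` K" "card Z = card Z'" "card Z < Suc b" for Z Z'
    proof (cases "card Z = b")
      case True
      then show ?thesis
        using const that by metis
    next
      case False
      then show ?thesis
        using fH that sub by (metis less_antisym order_trans)
    qed
    moreover have "card (g ` K) = m"
      using inj KN(3) by (simp add: card_image)
    ultimately show ?thesis
      using sub H(1) by (intro exI[of _ "g ` K"]) auto
  qed
  then show ?case
    by blast
qed

subsection \<open>Edges of the hypercube\<close>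

definition ones :: "bool list \<Rightarrow> nat set" where
  "ones x = {i. i < length x \<and> x ! i}"

definition vec :: "nat \<Rightarrow> nat set \<Rightarrow> bool list" where
  "vec n A = map (\<lambda>i. i \<in> A) [0..<n]"

lemma length_vec [simp]: "length (vec n A) = n"
  by (simp add: vec_def)

lemma ones_vec [simp]: "ones (vec n A) = A \<inter> {..<n}"
  by (auto simp: ones_def vec_def)

lemma vec_ones: "length x = n \<Longrightarrow> vec n (ones x) = x"
  by (auto simp: ones_def vec_def intro: nth_equalityI)

lemma ones_subset: "length x = n \<Longrightarrow> ones x \<subseteq> {..<n}"
  by (auto simp: ones_def)

lemma vec_eq_iff: "vec n A = vec n B \<longleftrightarrow> A \<inter> {..<n} = B \<inter> {..<n}"
  by (metis length_vec ones_vec vec_ones)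

lemma verts_hypercube: "x \<in> verts (hypercube n) \<longleftrightarrow> length x = n"
  by (simp add: hypercube_def)

text \<open>For \<open>p \<in> Z\<close>, \<open>Z\<close> is the set of ones of the upper endpoint
  and \<open>p\<close> the flipped coordinate; every edge has this form, so a colouring becomes a
  function of \<open>Z\<close> and \<open>p\<close>.\<close>

definition cedge :: "nat \<Rightarrow> nat set \<Rightarrow> nat \<Rightarrow> bool list set" where
  "cedge n Z p = {vec n (Z - {p}), vec n Z}"

lemma edge_hypercube_iff:
  "{x, y} \<in> edges (hypercube n) \<longleftrightarrow>
     length x = n \<and> length y = n \<and> (\<exists>p. sym_diff (ones x) (ones y) = {p})"
proof -
  define P where "P x y \<longleftrightarrow> length x = n \<and> length y = n \<and> card {i. i < n \<and> x ! i \<noteq> y ! i} = 1"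
    for x y :: "bool list"
  have sym: "P x y \<longleftrightarrow> P y x" for x y
  proof -
    have "{i. i < n \<and> y ! i \<noteq> x ! i} = {i. i < n \<and> x ! i \<noteq> y ! i}"
      by blast
    then show ?thesis
      unfolding P_def by metis
  qed
  have "edges (hypercube n) = {{x, y} | x y. P x y}"
    by (simp add: hypercube_def P_def)
  then have "{x, y} \<in> edges (hypercube n) \<longleftrightarrow> (\<exists>x' y'. {x, y} = {x', y'} \<and> P x' y')"
    by blast
  also have "\<dots> \<longleftrightarrow> P x y"
    using sym by (metis doubleton_eq_iff)
  also have "\<dots> \<longleftrightarrow> length x = n \<and> length y = n \<and> (\<exists>p. sym_diff (ones x) (ones y) = {p})"
  proof (cases "length x = n \<and> length y = n")
    case True
    then have eq: "{i. i < n \<and> x ! i \<noteq> y ! i} = sym_diff (ones x) (ones y)"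
      by (auto simp: ones_def)
    have "card D = 1 \<longleftrightarrow> (\<exists>p. D = {p})" for D :: "nat set"
      by (simp add: card_1_singleton_iff)
    from this[of "sym_diff (ones x) (ones y)"] show ?thesis
      unfolding P_def eq using True by argo
  next
    case False
    then show ?thesis
      unfolding P_def by argo
  qed
  finally show ?thesis .
qed

lemma simple_graph_hypercube: "simple_graph (hypercube n)"
  unfolding simple_graph_def
proof
  fix e assume e: "e \<in> edges (hypercube n)"
  then obtain x y where xy: "e = {x, y}" "length x = n" "length y = n"
    unfolding hypercube_def ugraph.simps mem_Collect_eq by blast
  with e have "\<exists>p. sym_diff (ones x) (ones y) = {p}"
    by (simp add: edge_hypercube_iff)
  then have "x \<noteq> y"
    by blast
  then show "e \<subseteq> verts (hypercube n) \<and> card e = 2"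
    by (simp add: xy verts_hypercube)
qed

lemma cedge_in_hypercube:
  assumes "p \<in> Z" "Z \<subseteq> {..<n}"
  shows "cedge n Z p \<in> edges (hypercube n)"
proof -
  have "sym_diff ((Z - {p}) \<inter> {..<n}) (Z \<inter> {..<n}) = {p}"
    using assms by blast
  then show ?thesis
    unfolding cedge_def edge_hypercube_iff ones_vec by (intro conjI length_vec exI[of _ p])
qed

lemma sym_diff_singleton_cases:
  assumes "sym_diff A B = {p}"
  obtains "p \<in> A" "B = A - {p}" | "p \<in> B" "A = B - {p}"
proof -
  have *: "(q \<in> A \<longleftrightarrow> q \<notin> B) \<longleftrightarrow> q = p" for q
  proof -
    have "q \<in> sym_diff A B \<longleftrightarrow> q = p"
      unfolding assms by simp
    then show ?thesis
      by blast
  qed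
  show ?thesis
  proof (cases "p \<in> A")
    case True
    then have "B = A - {p}"
      using * by (intro set_eqI) (metis DiffE DiffI singletonD singletonI)
    then show ?thesis
      using True that(1) by metis
  next
    case False
    then have "A = B - {p}" "p \<in> B"
      using * by (intro set_eqI, metis DiffE DiffI singletonD singletonI, metis)
    then show ?thesis
      using that(2) by metis
  qed
qed

lemma edge_hypercubeE:
  assumes "e \<in> edges (hypercube n)"
  obtains Z p where "p \<in> Z" "Z \<subseteq> {..<n}" "e = cedge n Z p"
proof -
  note goal = that
  obtain x y where e: "e = {x, y}" and len: "length x = n" "length y = n"
    using assms unfolding hypercube_def ugraph.simps mem_Collect_eq by blast
  with assms have "\<exists>p. sym_diff (ones x) (ones y) = {p}"
    by (simp add: edge_hypercube_iff)
  then obtain p where p: "sym_diff (ones x) (ones y) = {p}"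
    by blast
  have canon: thesis
    if xy: "e = {x, y}" "length x = n" "length y = n" "p \<in> ones y" "ones x = ones y - {p}" for x y
  proof (rule goal[of p "ones y"])
    have "vec n (ones y - {p}) = x" "vec n (ones y) = y"
      using xy by (metis vec_ones)+
    then show "e = cedge n (ones y) p"
      unfolding cedge_def xy(1) by simp
    show "ones y \<subseteq> {..<n}"
      using xy(3) by (rule ones_subset)
  qed (rule xy(4))
  from p show ?thesis
  proof (cases rule: sym_diff_singleton_cases)
    case 1
    show ?thesis
      using canon[of y x] 1 len e by (metis insert_commute)
  next
    case 2
    show ?thesis
      using canon[of x y] 2 len e by metis
  qed
qed

subsection \<open>Rigidity of punctured subcubes\<close>

text \<open>The set \<open>A\<close> is the symmetric difference with the deleted vertex.  Opposite edges of a 4-cycle have the same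
  direction, and adding elements to \<open>A\<close> never meets the deleted vertex \<open>{}\<close>, so that every edge can be compared
  with an edge at the full set.\<close>

lemma punctured_cube_rigid:
  fixes F :: "nat set \<Rightarrow> nat set"
  assumes d: "d \<ge> 2" and inj: "inj_on F (Pow {..<d} - {{}})"
    and adj: "\<And>A i. \<lbrakk>A \<subseteq> {..<d}; A \<noteq> {}; i < d; i \<notin> A\<rbrakk> \<Longrightarrow>
                \<exists>p. \<forall>q. q \<in> F (insert i A) \<longleftrightarrow> (q \<in> F A) \<noteq> (q = p)"
  shows "\<exists>g W. inj_on g {..<d} \<and>
           (\<forall>A\<subseteq>{..<d}. A \<noteq> {} \<longrightarrow> (\<forall>q. q \<in> F A \<longleftrightarrow> (q \<in> W) \<noteq> (q \<in> g ` A)))"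
proof -
  have "\<exists>p. \<forall>q. A \<subseteq> {..<d} \<longrightarrow> A \<noteq> {} \<longrightarrow> i < d \<longrightarrow> i \<notin> A \<longrightarrow>
          (q \<in> F (insert i A) \<longleftrightarrow> (q \<in> F A) \<noteq> (q = p))" for A i
    using adj[of A i] by blast
  then obtain D where D: "\<And>A i q. \<lbrakk>A \<subseteq> {..<d}; A \<noteq> {}; i < d; i \<notin> A\<rbrakk> \<Longrightarrow>
          q \<in> F (insert i A) \<longleftrightarrow> (q \<in> F A) \<noteq> (q = D A i)"
    by metis
  have square: "D (insert j A) i = D A i"
    if A: "A \<subseteq> {..<d}" "A \<noteq> {}" and ij: "i < d" "j < d" "i \<noteq> j" "i \<notin> A" "j \<notin> A" for A i j
  proof -
    have "insert i A \<noteq> insert j A"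
      using ij by blast
    then have "F (insert i A) \<noteq> F (insert j A)"
      using inj A ij by (simp add: inj_on_eq_iff)
    moreover have "F (insert i A) = F (insert j A)" if "D A i = D A j"
      using D[OF A ij(1,4)] D[OF A ij(2,5)] that by (intro set_eqI) simp
    ultimately have ne: "D A i \<noteq> D A j"
      by blast
    have "F (insert i (insert j A)) \<noteq> F A"
    proof -
      have "insert i (insert j A) \<noteq> A"
        using ij by blast
      then show ?thesis
        using inj A ij by (simp add: inj_on_eq_iff)
    qed
    moreover have "F (insert i (insert j A)) = F A" if "D (insert j A) i = D A j"
      using D[of "insert j A" i] D[OF A ij(2,5)] A ij that by (intro set_eqI) auto
    ultimately have ne': "D (insert j A) i \<noteq> D A j"
      by blast
    \<comment> \<open>The two paths around the 4-cycle flip the same coordinates. At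
      \<open>q = D A j\<close> this gives \<open>D (insert i A) j = D A j\<close>, and then at
      \<open>q = D A i\<close> it gives the claim.\<close>
    have "(((q \<in> F A) \<noteq> (q = D A j)) \<noteq> (q = D (insert j A) i)) =
          (((q \<in> F A) \<noteq> (q = D A i)) \<noteq> (q = D (insert i A) j))" for q
    proof -
      have "q \<in> F (insert i (insert j A)) \<longleftrightarrow> ((q \<in> F A) \<noteq> (q = D A j)) \<noteq> (q = D (insert j A) i)"
        using D[of "insert j A" i q] D[of A j q] A ij by simp
      moreover have "q \<in> F (insert j (insert i A)) \<longleftrightarrow> ((q \<in> F A) \<noteq> (q = D A i)) \<noteq> (q = D (insert i A) j)"
        using D[of "insert i A" j q] D[of A i q] A ij by simp
      moreover have "insert i (insert j A) = insert j (insert i A)"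
        by (rule insert_commute)
      ultimately show ?thesis
        by simp
    qed
    from this[of "D A i"] this[of "D A j"] show ?thesis
      using ne ne' by argo
  qed
  \<comment> \<open>The direction is read off at the largest set avoiding \<open>i\<close>;
    \<open>Dg\<close> climbs to it by applying \<open>square\<close> one element at a time.\<close>
  define g where "g i = D ({..<d} - {i}) i" for i
  have Dg: "D A i = g i" if "A \<subseteq> {..<d}" "A \<noteq> {}" "i < d" "i \<notin> A" for A i
    using that
  proof (induction "card ({..<d} - {i} - A)" arbitrary: A rule: less_induct)
    case less
    show ?case
    proof (cases "A = {..<d} - {i}")
      case True
      then show ?thesis
        by (simp add: g_def)
    next
      case False
      then obtain j where j: "j < d" "j \<noteq> i" "j \<notin> A"
        using less.prems by blast
      have "{..<d} - {i} - insert j A \<subset> {..<d} - {i} - A"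
        using j by auto
      then have "card ({..<d} - {i} - insert j A) < card ({..<d} - {i} - A)"
        by (intro psubset_card_mono) auto
      then have "D (insert j A) i = g i"
        using less.prems j by (intro less.hyps) auto
      then show ?thesis
        using square[of A i j] less.prems j by simp
    qed
  qed
  have step: "q \<in> F (insert i A) \<longleftrightarrow> (q \<in> F A) \<noteq> (q = g i)"
    if "A \<subseteq> {..<d}" "A \<noteq> {}" "i < d" "i \<notin> A" for A i q
    using D[OF that] Dg[OF that] by simp
  have ne: "{..<d} - {i} \<noteq> {}" for i
  proof
    assume "{..<d} - {i} = {}"
    then have "{..<d} \<subseteq> {i}"
      by blast
    then have "card {..<d} \<le> card {i}"
      by (intro card_mono) auto
    then show False
      using d by simp
  qed
  have inj_g: "inj_on g {..<d}"
  proof (rule inj_onI)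
    fix i j assume ij: "i \<in> {..<d}" "j \<in> {..<d}" "g i = g j"
    have "F ({..<d} - {i}) = F ({..<d} - {j})"
    proof (rule set_eqI)
      fix q
      show "q \<in> F ({..<d} - {i}) \<longleftrightarrow> q \<in> F ({..<d} - {j})"
        using step[of "{..<d} - {i}" i q] step[of "{..<d} - {j}" j q] ij ne[of i] ne[of j]
        by (auto simp: insert_absorb)
    qed
    then have "{..<d} - {i} = {..<d} - {j}"
      using inj_onD[OF inj, of "{..<d} - {i}" "{..<d} - {j}"] ne by blast
    then show "i = j"
      using ij by blast
  qed
  \<comment> \<open>\<open>W\<close> is the value that \<open>F\<close> would take at the missing
    empty set; \<open>F_eq\<close> descends to \<open>A\<close> from the full set, where the formula
    holds by this definition.\<close>
  define W where "W = {q. (q \<in> F {..<d}) \<noteq> (q \<in> g ` {..<d})}"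
  have F_eq: "q \<in> F A \<longleftrightarrow> (q \<in> W) \<noteq> (q \<in> g ` A)" if "A \<subseteq> {..<d}" "A \<noteq> {}" for A q
    using that
  proof (induction "card ({..<d} - A)" arbitrary: A rule: less_induct)
    case less
    show ?case
    proof (cases "A = {..<d}")
      case True
      then show ?thesis
        by (auto simp: W_def)
    next
      case False
      then obtain j where j: "j < d" "j \<notin> A"
        using less.prems by blast
      have "{..<d} - insert j A \<subset> {..<d} - A"
        using j by auto
      then have "card ({..<d} - insert j A) < card ({..<d} - A)"
        by (intro psubset_card_mono) auto
      then have "q \<in> F (insert j A) \<longleftrightarrow> (q \<in> W) \<noteq> (q \<in> g ` insert j A)"
        using less.prems j by (intro less.hyps) auto
      moreover have "g j \<notin> g ` A"
        using inj_g j less.prems by (auto simp: inj_on_def)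
      ultimately show ?thesis
        using step[of A j q] less.prems j by auto
    qed
  qed
  show ?thesis
    by (intro exI[of _ g] exI[of _ W] conjI allI impI inj_g F_eq)
qed

text \<open>Containing the cube minus \<open>v\<close> is common to vertex and edge deletion. By
  rigidity the embedding carries this part onto a subcube with star set \<open>S\<close>, with
  \<open>W\<close> in the place of \<open>v\<close>, so every edge of that subcube not meeting
  \<open>W\<close> belongs to \<open>H\<close>.\<close>

lemma embedding_contains_punctured_subcube:
  assumes d: "d \<ge> 2" and v: "length v = d"
    and verts: "verts (hypercube d) - {v} \<subseteq> verts G"
    and edges: "\<And>e. \<lbrakk>e \<in> edges (hypercube d); v \<notin> e\<rbrakk> \<Longrightarrow> e \<in> edges G"
    and emb: "embedding G n H"
  shows "\<exists>S W. S \<subseteq> {..<n} \<and> W \<subseteq> {..<n} \<and> card S = d \<and>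
           (\<forall>Z p. p \<in> S \<longrightarrow> p \<in> Z \<longrightarrow> Z - S = W - S \<longrightarrow> Z \<noteq> W \<longrightarrow> Z - {p} \<noteq> W \<longrightarrow> cedge n Z p \<in> edges H)"
proof -
  obtain f where f: "bij_betw f (verts G) (verts H)"
    and f_edge: "\<And>x y. \<lbrakk>x \<in> verts G; y \<in> verts G; {x, y} \<in> edges G\<rbrakk> \<Longrightarrow> {f x, f y} \<in> edges H"
    using emb unfolding embedding_def isomorphic_def by blast
  have H: "verts H \<subseteq> verts (hypercube n)" "edges H \<subseteq> edges (hypercube n)"
    using emb by (auto simp: embedding_def subgraph_def)
  \<comment> \<open>Coordinates relative to \<open>v\<close>: \<open>rel T\<close> differs from
    \<open>v\<close> exactly on \<open>T\<close>, so that the deleted vertex becomes the empty set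
    of the rigidity lemma.\<close>
  define rel where "rel T = vec d {q. (q \<in> ones v) \<noteq> (q \<in> T)}" for T
  have ones_rel: "q \<in> ones (rel T) \<longleftrightarrow> (q \<in> ones v) \<noteq> (q \<in> T)" if "T \<subseteq> {..<d}" for T q
    using that ones_subset[OF v] by (auto simp: rel_def)
  have len_rel: "length (rel T) = d" for T
    by (simp add: rel_def)
  have rel_ne: "rel T \<noteq> v" if "T \<subseteq> {..<d}" "T \<noteq> {}" for T
    using ones_rel[OF that(1)] that(2) by auto
  have rel_vert: "rel T \<in> verts G" if "T \<subseteq> {..<d}" "T \<noteq> {}" for T
    using verts rel_ne[OF that] len_rel by (auto simp: verts_hypercube)
  have rel_edge: "{f (rel A), f (rel (insert i A))} \<in> edges H"
    if "A \<subseteq> {..<d}" "A \<noteq> {}" "i < d" "i \<notin> A" for A i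
  proof (rule f_edge)
    have iA: "insert i A \<subseteq> {..<d}"
      using that by blast
    have "sym_diff (ones (rel A)) (ones (rel (insert i A))) = {i}"
    proof (rule set_eqI)
      fix q
      show "q \<in> sym_diff (ones (rel A)) (ones (rel (insert i A))) \<longleftrightarrow> q \<in> {i}"
        using ones_rel[OF that(1), of q] ones_rel[OF iA, of q] that(4) by auto
    qed
    then have "{rel A, rel (insert i A)} \<in> edges (hypercube d)"
      unfolding edge_hypercube_iff by (intro conjI len_rel exI[of _ i])
    then show "{rel A, rel (insert i A)} \<in> edges G"
      using rel_ne[of A] rel_ne[OF iA] that by (intro edges) auto
    show "rel A \<in> verts G" "rel (insert i A) \<in> verts G"
      using rel_vert that iA by auto
  qed
  define F where "F T = ones (f (rel T))" for T
  have len_f: "length (f (rel T)) = n" if "T \<subseteq> {..<d}" "T \<noteq> {}" for T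
    using bij_betw_apply[OF f rel_vert[OF that]] H(1) by (auto simp flip: verts_hypercube)
  have vec_F: "vec n (F T) = f (rel T)" if "T \<subseteq> {..<d}" "T \<noteq> {}" for T
    using len_f[OF that] by (simp add: F_def vec_ones)
  have F_sub: "F T \<subseteq> {..<n}" if "T \<subseteq> {..<d}" "T \<noteq> {}" for T
    using len_f[OF that] by (simp add: F_def ones_subset)
  have "inj_on F (Pow {..<d} - {{}})"
  proof (rule inj_onI)
    fix A B assume AB: "A \<in> Pow {..<d} - {{}}" "B \<in> Pow {..<d} - {{}}" "F A = F B"
    then have "f (rel A) = f (rel B)"
      using vec_F[of A] vec_F[of B] by simp
    then have "rel A = rel B"
      using inj_onD[OF bij_betw_imp_inj_on[OF f], of "rel A" "rel B"] rel_vert AB by blast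
    then show "A = B"
      using ones_rel[of A] ones_rel[of B] AB by (intro set_eqI) auto
  qed
  moreover have "\<exists>p. \<forall>q. q \<in> F (insert i A) \<longleftrightarrow> (q \<in> F A) \<noteq> (q = p)"
    if "A \<subseteq> {..<d}" "A \<noteq> {}" "i < d" "i \<notin> A" for A i
  proof -
    have "{f (rel A), f (rel (insert i A))} \<in> edges (hypercube n)"
      using rel_edge[OF that] H(2) by blast
    then obtain p where p: "sym_diff (F A) (F (insert i A)) = {p}"
      unfolding edge_hypercube_iff F_def by metis
    have "q \<in> F (insert i A) \<longleftrightarrow> (q \<in> F A) \<noteq> (q = p)" for q
    proof -
      have "q \<in> sym_diff (F A) (F (insert i A)) \<longleftrightarrow> q = p"
        unfolding p by simp
      then show ?thesis
        by blast
    qed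
    then show ?thesis
      by metis
  qed
  ultimately obtain g W where g: "inj_on g {..<d}"
    and FW: "\<And>A q. \<lbrakk>A \<subseteq> {..<d}; A \<noteq> {}\<rbrakk> \<Longrightarrow> q \<in> F A \<longleftrightarrow> (q \<in> W) \<noteq> (q \<in> g ` A)"
    using punctured_cube_rigid[OF d, of F] by metis
  define S where "S = g ` {..<d}"
  have g_sub: "g i < n" if "i < d" for i
  proof -
    \<comment> \<open>\<open>F {j}\<close> and \<open>F {i, j}\<close> differ exactly at
      \<open>g i\<close>, so \<open>g i\<close> lies in one of them and is therefore below
      \<open>n\<close>; \<open>d \<ge> 2\<close> supplies the index \<open>j\<close>.\<close>
    define j where "j = (if i = 0 then 1 else 0 :: nat)"
    have j: "j < d" "j \<noteq> i"
      using d by (auto simp: j_def)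
    have "g i \<notin> g ` {j}"
      using g j that by (auto simp: inj_on_def)
    then have "g i \<in> F {j} \<or> g i \<in> F {i, j}"
      using FW[of "{j}" "g i"] FW[of "{i, j}" "g i"] j that by auto
    then show ?thesis
      using F_sub[of "{j}"] F_sub[of "{i, j}"] j that by auto
  qed
  have d0: "{..<d} \<noteq> {}"
    using d by (simp add: lessThan_empty_iff)
  have W_sub: "W \<subseteq> {..<n}"
  proof
    fix q assume q: "q \<in> W"
    show "q \<in> {..<n}"
    proof (cases "q \<in> S")
      case True
      then show ?thesis
        using g_sub by (auto simp: S_def)
    next
      case False
      then have "q \<in> F {..<d}"
        using q FW[OF subset_refl d0, of q] by (simp add: S_def)
      then show ?thesis
        using F_sub[OF subset_refl d0] by blast
    qed
  qed
  have S_sub: "S \<subseteq> {..<n}"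
    using g_sub by (auto simp: S_def)
  have card_S: "card S = d"
    using g by (simp add: S_def card_image)
  have edge: "cedge n Z p \<in> edges H"
    if p: "p \<in> S" "p \<in> Z" and Z: "Z - S = W - S" "Z \<noteq> W" "Z - {p} \<noteq> W" for Z p
  proof -
    \<comment> \<open>\<open>T Y\<close> lists the directions in which \<open>Y\<close> departs from
      \<open>W\<close>; this inverts \<open>F\<close> on the vertices of the subcube other than
      \<open>W\<close>.\<close>
    define T where "T Y = {i. i < d \<and> (g i \<in> Y) \<noteq> (g i \<in> W)}" for Y
    have T_sub: "T Y \<subseteq> {..<d}" for Y
      by (auto simp: T_def)
    have T_ne: "T Y \<noteq> {}" and FT: "F (T Y) = Y" if Y: "Y - S = W - S" "Y \<noteq> W" for Y
    proof -
      obtain q where q: "(q \<in> Y) \<noteq> (q \<in> W)"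
        using Y(2) by blast
      then have "q \<in> S"
        using Y(1) by blast
      then show ne: "T Y \<noteq> {}"
        using q by (auto simp: T_def S_def)
      show "F (T Y) = Y"
      proof (rule set_eqI)
        fix q
        have "q \<in> g ` T Y \<longleftrightarrow> q \<in> S \<and> (q \<in> Y) \<noteq> (q \<in> W)"
          by (auto simp: T_def S_def)
        then show "q \<in> F (T Y) \<longleftrightarrow> q \<in> Y"
          using FW[OF T_sub ne, of q] Y(1) by blast
      qed
    qed
    have Z': "(Z - {p}) - S = W - S"
      using Z(1) p(1) by blast
    obtain i where i: "i < d" "p = g i"
      using p(1) by (auto simp: S_def)
    have gi: "g j = g i \<longleftrightarrow> j = i" if "j < d" for j
      using g i(1) that by (auto simp: inj_on_def)
    have "{f (rel (T (Z - {p}))), f (rel (T Z))} \<in> edges H"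
    \<comment> \<open>Removing \<open>g i\<close> from \<open>Z\<close> moves away from
      \<open>W\<close> if \<open>g i \<in> W\<close> and towards it otherwise, which decides which
      of the two index sets is the larger.\<close>
    proof (cases "g i \<in> W")
      case True
      then have "T (Z - {p}) = insert i (T Z)" "i \<notin> T Z"
        using i p(2) gi by (auto simp: T_def)
      then show ?thesis
        using rel_edge[OF T_sub T_ne[OF Z(1,2)] i(1)] by (simp add: insert_commute)
    next
      case False
      then have "T Z = insert i (T (Z - {p}))" "i \<notin> T (Z - {p})"
        using i p(2) gi by (auto simp: T_def)
      then show ?thesis
        using rel_edge[OF T_sub T_ne[OF Z' Z(3)] i(1)] by simp
    qed
    then show ?thesis
      unfolding cedge_def
      using vec_F[OF T_sub T_ne[OF Z(1,2)]] vec_F[OF T_sub T_ne[OF Z' Z(3)]] FT[OF Z(1,2)] FT[OF Z' Z(3)]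
      by simp
  qed
  show ?thesis
    by (intro exI[of _ S] exI[of _ W] conjI allI impI W_sub S_sub card_S edge)
qed

subsection \<open>The colouring for the lower bound\<close>

lemma card_less_if_witness:
  assumes "finite B" "A \<subseteq> B" "a \<in> B" "a \<notin> A"
  shows "card A < card B"
  using assms by (metis psubsetI psubset_card_mono)

text \<open>Ranks increase strictly along \<open>S\<close> and stay below \<open>card S\<close>, so
  they take every value below it.\<close>

lemma ex_rank_eq:
  fixes S :: "nat set"
  assumes "finite S" "i < card S"
  shows "\<exists>p\<in>S. card {q \<in> S. q < p} = i"
proof -
  define rank where "rank p = card {q \<in> S. q < p}" for p
  have mono: "rank p < rank p'" if "p \<in> S" "p' \<in> S" "p < p'" for p p'
    unfolding rank_def by (rule card_less_if_witness[where a = p]) (use assms(1) that in auto)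
  have less: "rank p < card S" if "p \<in> S" for p
    unfolding rank_def by (rule card_less_if_witness[where a = p]) (use assms(1) that in auto)
  have "inj_on rank S"
    by (rule inj_onI) (metis mono less_irrefl linorder_neqE_nat)
  then have "card (rank ` S) = card {..<card S}"
    by (simp add: card_image)
  moreover have "rank ` S \<subseteq> {..<card S}"
    using less by blast
  ultimately have "rank ` S = {..<card S}"
    by (intro card_subset_eq) auto
  then have "i \<in> rank ` S"
    using assms(2) by simp
  then show ?thesis
    unfolding rank_def by blast
qed

lemma card_below_above:
  fixes S :: "nat set"
  assumes "finite S" "p \<in> S"
  shows "card {q \<in> S. q < p} + card {q \<in> S. p < q} + 1 = card S"
proof -
  have "S = insert p ({q \<in> S. q < p} \<union> {q \<in> S. p < q})"
    using assms(2) by auto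
  then have "card S = card (insert p ({q \<in> S. q < p} \<union> {q \<in> S. p < q}))"
    by simp
  also have "\<dots> = Suc (card ({q \<in> S. q < p} \<union> {q \<in> S. p < q}))"
    using assms(1) by (subst card_insert_disjoint) auto
  also have "card ({q \<in> S. q < p} \<union> {q \<in> S. p < q}) = card {q \<in> S. q < p} + card {q \<in> S. p < q}"
    using assms(1) by (intro card_Un_disjoint) auto
  finally show ?thesis
    by simp
qed

lemma ex_other_subset:
  assumes "finite L" "0 < x" "x < card L"
  shows "\<exists>A\<subseteq>L. card A = x \<and> A \<noteq> X"
proof -
  obtain A where A: "A \<subseteq> L" "card A = x"
    using assms obtain_subset_with_card_n[of x L] by (metis less_imp_le)
  have finA: "finite A"
    using A(1) assms(1) finite_subset by blast
  obtain a where a: "a \<in> A"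
    using A(2) assms(2) by fastforce
  obtain b where b: "b \<in> L" "b \<notin> A"
    using A assms(3) by (metis less_irrefl subsetI subset_antisym)
  have "card (insert b (A - {a})) = x"
    using a b A(2) finA assms(2) by (subst card_insert_disjoint) auto
  moreover have "insert b (A - {a}) \<subseteq> L" "insert b (A - {a}) \<noteq> A"
    using A b by auto
  ultimately show ?thesis
    using A by metis
qed

text \<open>A rectangle loses a cell through the deletion of the vertex \<open>W\<close> only if it is a corner of the rectangle.\<close>

lemma ex_subset_pair_avoiding:
  assumes fin: "finite L" "finite R" and xy: "x \<le> card L" "y \<le> card R"
    and free: "\<not> (card (W \<inter> L) = x \<and> card (W \<inter> R) = y \<and> (x = 0 \<or> x = card L) \<and> (y = 0 \<or> y = card R))"
  shows "\<exists>A B. A \<subseteq> L \<and> B \<subseteq> R \<and> card A = x \<and> card B = y \<and> \<not> (A = W \<inter> L \<and> B = W \<inter> R)"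
proof -
  obtain A B where A: "A \<subseteq> L" "card A = x" and B: "B \<subseteq> R" "card B = y"
    using xy by (metis obtain_subset_with_card_n)
  consider "card (W \<inter> L) \<noteq> x \<or> card (W \<inter> R) \<noteq> y" | "0 < x" "x < card L" | "0 < y" "y < card R"
    using free xy by linarith
  then show ?thesis
  proof cases
    case 1
    then show ?thesis
      using A B by blast
  next
    case 2
    then obtain A' where "A' \<subseteq> L" "card A' = x" "A' \<noteq> W \<inter> L"
      using ex_other_subset[OF fin(1)] by blast
    then show ?thesis
      using B by blast
  next
    case 3
    then obtain B' where "B' \<subseteq> R" "card B' = y" "B' \<noteq> W \<inter> R"
      using ex_other_subset[OF fin(2)] by blast
    then show ?thesis
      using A by blast
  qed
qed

text \<open>The two coordinates of the colour are encoded as a single number below \<open>(k - 1) * (k + 2)\<close>.\<close>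

definition cube_colour :: "nat \<Rightarrow> bool list set \<Rightarrow> nat" where
  "cube_colour k e =
     (let Z = (\<Union>x\<in>e. ones x); U = (\<Inter>x\<in>e. ones x); p = the_elem (Z - U) in
      (card U mod (k - 1)) * (k + 2) + (card {q \<in> U. q < p} + card U div (k - 1)) mod (k + 2))"

lemma cube_colour_cedge:
  assumes "p \<in> Z" "Z \<subseteq> {..<n}"
  shows "cube_colour k (cedge n Z p) =
           (card (Z - {p}) mod (k - 1)) * (k + 2) +
           (card {q \<in> Z - {p}. q < p} + card (Z - {p}) div (k - 1)) mod (k + 2)"
proof -
  have "(Z - {p}) \<inter> {..<n} = Z - {p}" "Z \<inter> {..<n} = Z"
    using assms by auto
  then have "(\<Union>x\<in>cedge n Z p. ones x) = Z" "(\<Inter>x\<in>cedge n Z p. ones x) = Z - {p}"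
    by (auto simp: cedge_def)
  moreover have "Z - (Z - {p}) = {p}"
    using assms by auto
  ultimately show ?thesis
    by (simp add: cube_colour_def Let_def)
qed

lemma cube_colour_less:
  assumes "k \<ge> 3"
  shows "cube_colour k e < (k - 1) * (k + 2)"
proof -
  have "a * (k + 2) + b < (k - 1) * (k + 2)" if "a < k - 1" "b < k + 2" for a b
  proof -
    have "a * (k + 2) + b < (a + 1) * (k + 2)"
      using that by simp
    also have "\<dots> \<le> (k - 1) * (k + 2)"
      using that by (intro mult_right_mono) auto
    finally show ?thesis .
  qed
  then show ?thesis
    using assms by (simp add: cube_colour_def Let_def)
qed

lemma ex_shift_mod:
  fixes N :: nat
  assumes "P < N"
  shows "\<exists>i<N. (s + i) mod N = P"
proof -
  have "(s + (P + (N - s mod N)) mod N) mod N = (s mod N + (P + (N - s mod N))) mod N"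
    by (simp add: mod_simps)
  also have "s mod N + (P + (N - s mod N)) = P + N"
    using assms mod_less_divisor[of N s] by linarith
  finally show ?thesis
    using assms by (intro exI[of _ "(P + (N - s mod N)) mod N"]) simp
qed

text \<open>Put \<open>x\<close> free ones left and \<open>y\<close> free ones right of the star.
  Since \<open>x + y = i + m * (k - 1)\<close>, the total keeps the residue prescribed by
  \<open>i\<close> while its quotient grows by \<open>m\<close>, so the second colour coordinate
  moves by \<open>x + m\<close>. The assumption \<open>free\<close> says that the cell is not a
  corner occupied by \<open>W\<close>.\<close>

lemma star_hits_colour:
  assumes k: "k \<ge> 3" and S: "S \<subseteq> {..<n}" and W: "W \<subseteq> {..<n}" and p: "p \<in> S"
    and L: "L = {q \<in> S. q < p}" and R: "R = {q \<in> S. p < q}"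
    and xy: "x \<le> card L" "y \<le> card R"
    and free: "\<not> (card (W \<inter> L) = x \<and> card (W \<inter> R) = y \<and> (x = 0 \<or> x = card L) \<and> (y = 0 \<or> y = card R))"
    and sum: "x + y = i + m * (k - 1)"
    and P: "(card (W - S) + i) mod (k - 1) = c div (k + 2)"
    and Q: "(card {q \<in> W - S. q < p} + (card (W - S) + i) div (k - 1) + x + m) mod (k + 2) = c mod (k + 2)"
  shows "\<exists>Z p. p \<in> S \<and> p \<in> Z \<and> Z \<subseteq> {..<n} \<and> Z - S = W - S \<and> Z \<noteq> W \<and> Z - {p} \<noteq> W \<and>
           cube_colour k (cedge n Z p) = c"
proof -
  have fin: "finite S" "finite W"
    using S W finite_subset by blast+
  then have finLR: "finite L" "finite R"
    by (auto simp: L R)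
  obtain A B where A: "A \<subseteq> L" "card A = x" and B: "B \<subseteq> R" "card B = y"
    and AB: "\<not> (A = W \<inter> L \<and> B = W \<inter> R)"
    using ex_subset_pair_avoiding[OF finLR xy free] by blast
  define U where "U = (W - S) \<union> (A \<union> B)"
  have finAB: "finite A" "finite B"
    using A B finLR finite_subset by blast+
  have AB_disj: "A \<inter> B = {}"
    using A(1) B(1) by (force simp: L R)
  have pU: "p \<notin> U"
    using p A(1) B(1) by (auto simp: U_def L R)
  \<comment> \<open>Both endpoints of the edge meet \<open>S - {p}\<close> in
    \<open>A \<union> B\<close>, so \<open>ne\<close> excludes \<open>W\<close> from either
    endpoint, whether or not \<open>p \<in> W\<close>.\<close>
  have "W \<inter> L = A \<and> W \<inter> R = B" if "W \<inter> (S - {p}) = A \<union> B"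
    using that A(1) B(1) by (auto simp: L R)
  then have ne: "W \<inter> (S - {p}) \<noteq> A \<union> B"
    using AB by blast
  have U_S: "U \<inter> (S - {p}) = A \<union> B"
    using A(1) B(1) by (auto simp: U_def L R)
  have cardU: "card U = card (W - S) + i + m * (k - 1)"
  proof -
    have "card U = card (W - S) + card (A \<union> B)"
      unfolding U_def using A(1) B(1) fin finAB by (intro card_Un_disjoint) (auto simp: L R)
    also have "card (A \<union> B) = x + y"
      unfolding A(2)[symmetric] B(2)[symmetric] using finAB AB_disj
      by (intro card_Un_disjoint)
    finally show ?thesis
      using sum by simp
  qed
  have below: "card {q \<in> U. q < p} = card {q \<in> W - S. q < p} + x"
  proof -
    have "{q \<in> U. q < p} = {q \<in> W - S. q < p} \<union> A"
      using A(1) B(1) by (auto simp: U_def L R)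
    moreover have "card ({q \<in> W - S. q < p} \<union> A) = card {q \<in> W - S. q < p} + card A"
      using A(1) fin finAB by (intro card_Un_disjoint) (auto simp: L)
    ultimately show ?thesis
      using A(2) by simp
  qed
  have "U \<subseteq> {..<n}"
    using A(1) B(1) S W by (auto simp: U_def L R)
  then have Z_sub: "insert p U \<subseteq> {..<n}"
    using p S by auto
  have k1: "k - 1 > 0"
    using k by simp
  have colour: "cube_colour k (cedge n (insert p U) p) = c"
  proof -
    have "insert p U - {p} = U"
      using pU by auto
    moreover have "card U mod (k - 1) = c div (k + 2)"
      unfolding cardU using P by (simp only: mod_mult_self1)
    moreover have "card U div (k - 1) = (card (W - S) + i) div (k - 1) + m"
      unfolding cardU using k1 by simp
    ultimately have "cube_colour k (cedge n (insert p U) p) = (c div (k + 2)) * (k + 2) +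
        (card {q \<in> W - S. q < p} + x + ((card (W - S) + i) div (k - 1) + m)) mod (k + 2)"
      by (simp only: cube_colour_cedge[OF insertI1 Z_sub] below)
    also have "card {q \<in> W - S. q < p} + x + ((card (W - S) + i) div (k - 1) + m) =
        card {q \<in> W - S. q < p} + (card (W - S) + i) div (k - 1) + x + m"
      by (simp only: ac_simps)
    finally show ?thesis
      unfolding Q by (simp only: div_mult_mod_eq)
  qed
  have agree: "insert p U - S = W - S"
    using p A(1) B(1) by (auto simp: U_def L R)
  have "insert p U \<inter> (S - {p}) = A \<union> B"
    using U_S by auto
  then have ne1: "insert p U \<noteq> W"
    using ne by metis
  have ne2: "insert p U - {p} \<noteq> W"
    using U_S ne pU by (metis Diff_insert_absorb)
  show ?thesis
    by (intro exI[of _ "insert p U"] exI[of _ p] conjI p insertI1 Z_sub agree ne1 ne2 colour)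
qed

text \<open>The target colour fixes \<open>i\<close>, the required shift of the number of ones, and
  \<open>z\<close>, the required residue of \<open>x + m\<close> modulo \<open>k + 2\<close>. A star
  must offer a cell with \<open>x + y = i + m * (k - 1)\<close>. Position \<open>k\<close> offers
  the rectangle \<open>x \<le> k\<close>, \<open>y \<le> k - 1\<close>, where
  \<open>m = 0, 1, 2\<close> together reach every \<open>z\<close>; in only two cases is the chosen
  cell a corner that \<open>W\<close> can occupy.\<close>

lemma punctured_subcube_has_all_colours:
  assumes k: "k \<ge> 3" and S: "S \<subseteq> {..<n}" and W: "W \<subseteq> {..<n}" and card_S: "card S = 2 * k"
    and c: "c < (k - 1) * (k + 2)"
  shows "\<exists>Z p. p \<in> S \<and> p \<in> Z \<and> Z \<subseteq> {..<n} \<and> Z - S = W - S \<and> Z \<noteq> W \<and> Z - {p} \<noteq> W \<and>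
           cube_colour k (cedge n Z p) = c" (is ?thesis)
proof -
  have fin: "finite S"
    using S finite_subset by blast
  have "c div (k + 2) < k - 1"
    using c by (simp add: less_mult_imp_div_less)
  then obtain i where i: "i < k - 1" and P: "(card (W - S) + i) mod (k - 1) = c div (k + 2)"
    using ex_shift_mod by blast
  define t where "t = (card (W - S) + i) div (k - 1)"
  define l where "l p = card {q \<in> W - S. q < p}" for p
  have hit: ?thesis
    if "p \<in> S" "x \<le> card {q \<in> S. q < p}" "y \<le> card {q \<in> S. p < q}"
      "x + y = i + m * (k - 1)" "(l p + t + z) mod (k + 2) = c mod (k + 2)" "x + m = z \<or> x + m = z + (k + 2)"
      "\<not> (card (W \<inter> {q \<in> S. q < p}) = x \<and> card (W \<inter> {q \<in> S. p < q}) = y \<and>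
          (x = 0 \<or> x = card {q \<in> S. q < p}) \<and> (y = 0 \<or> y = card {q \<in> S. p < q}))"
    for p x y m z
  proof -
    have "(card {q \<in> W - S. q < p} + (card (W - S) + i) div (k - 1) + x + m) mod (k + 2) = c mod (k + 2)"
    proof -
      have "l p + t + x + m = l p + t + z \<or> l p + t + x + m = l p + t + z + (k + 2)"
        using that(6) by linarith
      then show ?thesis
        unfolding l_def[symmetric] t_def[symmetric] that(5)[symmetric] by (metis mod_add_self2)
    qed
    from star_hits_colour[OF k S W that(1) refl refl that(2,3) that(7) that(4) P this]
    show ?thesis .
  qed
  have lt: "k < card S" "k - 1 < card S"
    using card_S k by linarith+
  obtain p where p: "p \<in> S" "card {q \<in> S. q < p} = k"
    using ex_rank_eq[OF fin lt(1)] by blast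
  obtain p' where p': "p' \<in> S" "card {q \<in> S. q < p'} = k - 1"
    using ex_rank_eq[OF fin lt(2)] by blast
  define L where "L = {q \<in> S. q < p}"
  define R where "R = {q \<in> S. p < q}"
  define L' where "L' = {q \<in> S. q < p'}"
  define R' where "R' = {q \<in> S. p' < q}"
  have finLR: "finite L" "finite R" "finite L'" "finite R'"
    using fin by (auto simp: L_def R_def L'_def R'_def)
  have cards: "card L = k" "card R = k - 1" "card L' = k - 1" "card R' = k"
    using p(2) p'(2) card_below_above[OF fin p(1)] card_below_above[OF fin p'(1)] card_S k
    unfolding L_def R_def L'_def R'_def by linarith+
  have "p' < p"
  proof (rule ccontr)
    assume "\<not> p' < p"
    then have "L \<subseteq> L'"
      by (auto simp: L_def L'_def)
    from card_mono[OF finLR(3) this] show False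
      using cards k by linarith
  qed
  then have sub: "L' \<subseteq> L" "R \<subseteq> R'" "R' \<subseteq> insert p R \<union> L"
    by (auto simp: L_def R_def L'_def R'_def)
  obtain z where z: "z < k + 2" "(l p + t + z) mod (k + 2) = c mod (k + 2)"
    using ex_shift_mod[of "c mod (k + 2)" "k + 2" "l p + t"] by auto
  obtain z' where z': "z' < k + 2" "(l p' + t + z') mod (k + 2) = c mod (k + 2)"
    using ex_shift_mod[of "c mod (k + 2)" "k + 2" "l p' + t"] by auto
  note hitp = hit[OF p(1) _ _ _ z(2), folded L_def R_def, unfolded cards]
  note hitp' = hit[OF p'(1) _ _ _ z'(2), folded L'_def R'_def, unfolded cards]
  text \<open>In the cases \<open>tl\<close> and \<open>br\<close> the star \<open>p\<close> loses the top left or bottom right corner of its rectangle, and the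
    star \<open>p'\<close> takes over.\<close>
  consider (low) "z \<le> i" "z > 0 \<or> i > 0" | (bl) "z = 0" "i = 0"
    | (top) "z = k + 1" "i = 0" | (high) "z > i" "z \<le> i + k" "\<not> (i = 0 \<and> z = 1 \<and> card (W \<inter> L) = 0 \<and> card (W \<inter> R) = k - 1)"
        "\<not> (i = 1 \<and> z = k + 1 \<and> card (W \<inter> L) = k \<and> card (W \<inter> R) = 0)"
    | (tl) "i = 0" "card (W \<inter> L) = 0" "card (W \<inter> R) = k - 1"
    | (br) "i = 1" "card (W \<inter> L) = k" "card (W \<inter> R) = 0"
    using z(1) by linarith
  then show ?thesis
  proof cases
    case low
    show ?thesis
      by (rule hitp[of z "i - z" 0]) (use low i k in auto)
  next
    \<comment> \<open>The cell \<open>(0, 0)\<close> might be \<open>W\<close>. With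
      \<open>m = 2\<close> and \<open>x = k\<close> the value \<open>x + m = k + 2\<close> has the
      same residue, and \<open>y = k - 2\<close> lies strictly between its bounds.\<close>
    case bl
    show ?thesis
      by (rule hitp[of k "k - 2" 2]) (use bl k in auto)
  next
    \<comment> \<open>For \<open>i = 0\<close> the cells with \<open>m = 1\<close> end at
      \<open>z = k\<close>, so \<open>m = 2\<close> takes over; \<open>x = k - 1\<close> is not
      extreme.\<close>
    case top
    show ?thesis
      by (rule hitp[of "k - 1" "k - 1" 2]) (use top k in auto)
  next
    \<comment> \<open>Among the cells with \<open>m = 1\<close> the only corners are
      \<open>(0, k - 1)\<close> and \<open>(k, 0)\<close>; the case conditions ensure that
      \<open>W\<close> does not sit there.\<close>
    case high
    show ?thesis
      by (rule hitp[of "z - 1" "i + k - z" 1]) (use high i k z(1) in \<open>linarith | smt (verit)\<close>)+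
  next
    case tl
    have "card (W \<inter> R') > 0"
    proof -
      have "card (W \<inter> R) \<le> card (W \<inter> R')"
        using sub(2) finLR by (intro card_mono) auto
      then show ?thesis
        using tl k by linarith
    qed
    \<comment> \<open>\<open>W\<close> has ones right of \<open>p'\<close>, so no corner with
      \<open>y = 0\<close> is lost, and \<open>y < k\<close> excludes the other corners.\<close>
    then have free: "\<not> (card (W \<inter> L') = x \<and> card (W \<inter> R') = y \<and> (x = 0 \<or> x = k - 1) \<and> (y = 0 \<or> y = k))"
      if "y < k" for x y
      using that by auto
    consider "z' = 0" | "0 < z'" "z' \<le> k" | "z' = k + 1"
      using z'(1) by linarith
    then show ?thesis
    proof cases
      case 1
      show ?thesis
        by (rule hitp'[of 0 0 0, OF _ _ _ _ free]) (use 1 tl k in auto)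
    next
      case 2
      show ?thesis
        by (rule hitp'[of "z' - 1" "k - z'" 1, OF _ _ _ _ free]) (use 2 tl k in auto)
    next
      case 3
      show ?thesis
        by (rule hitp'[of "k - 1" "k - 1" 2, OF _ _ _ _ free]) (use 3 tl k in auto)
    qed
  next
    case br
    have "W \<inter> L = L"
      using br(2) cards(1) finLR(1) by (intro card_subset_eq) auto
    then have "W \<inter> L' = L'"
      using sub(1) by blast
    then have WL': "card (W \<inter> L') = k - 1"
      using cards(3) by simp
    have "W \<inter> R = {}"
      using br(3) finLR(2) by simp
    moreover have "R' - insert p R = {}"
    proof -
      have "card (insert p R) = k"
        using cards(2) finLR(2) k by (subst card_insert_disjoint) (auto simp: R_def)
      moreover have "insert p R \<subseteq> R'"
        using sub(2) p(1) \<open>p' < p\<close> by (auto simp: R'_def)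
      ultimately have "insert p R = R'"
        using cards(4) finLR(4) by (intro card_subset_eq) auto
      then show ?thesis
        by blast
    qed
    ultimately have "W \<inter> R' \<subseteq> {p}"
      by blast
    then have WR': "card (W \<inter> R') < k"
      using card_mono[of "{p}" "W \<inter> R'"] k by simp
    \<comment> \<open>Apart from \<open>(k - 1, k)\<close> the cells chosen below are not corners,
      and that one would be lost only if \<open>W\<close> filled \<open>R'\<close>, contrary to
      \<open>WR'\<close>.\<close>
    consider "z' = 0" | "z' = 1" | "1 < z'" "z' \<le> k" | "z' = k + 1"
      using z'(1) by linarith
    then show ?thesis
    proof cases
      case 1
      show ?thesis
        by (rule hitp'[of 0 1 0]) (use 1 br k WL' in auto)
    next
      case 2
      show ?thesis
        by (rule hitp'[of 1 0 0]) (use 2 br k WL' in auto)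
    next
      case 3
      show ?thesis
        by (rule hitp'[of "z' - 1" "k + 1 - z'" 1]) (use 3 br k in auto)
    next
      case 4
      show ?thesis
        by (rule hitp'[of "k - 1" k 2]) (use 4 br k WR' in auto)
    qed
  qed
qed

subsection \<open>The upper bound\<close>

text \<open>Any star set \<open>S\<close> with fixed ones \<open>W\<close> carries a copy of
  \<open>G\<close>, placed so that the position of \<open>v\<close> is the bottom vertex
  \<open>W\<close> of the subcube. If no edge of \<open>G\<close> meets \<open>v\<close>, then no
  edge of the copy has \<open>W\<close> as its lower endpoint.\<close>

lemma cube_embedding:
  assumes simple: "simple_graph G" and verts: "verts G \<subseteq> verts (hypercube d)"
    and edges: "edges G \<subseteq> edges (hypercube d)" and v: "length v = d"
    and S: "S \<subseteq> {..<n}" "card S = d" and W: "W \<subseteq> {..<n}" "W \<inter> S = {}"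
  shows "\<exists>H. embedding G n H \<and>
           (\<forall>e\<in>edges H. \<exists>Z p. e = cedge n Z p \<and> p \<in> S \<and> p \<in> Z \<and> Z \<subseteq> {..<n} \<and> Z - S = W \<and>
              ((\<forall>e\<in>edges G. v \<notin> e) \<longrightarrow> Z - {p} \<noteq> W))"
proof -
  have finS: "finite S"
    using S(1) finite_subset by blast
  obtain h where h: "bij_betw h {..<d} S"
    using ex_bij_betw_nat_finite[OF finS] S(2) by (auto simp: atLeast0LessThan)
  have h_inj: "h i = h j \<longleftrightarrow> i = j" if "i < d" "j < d" for i j
    using bij_betw_imp_inj_on[OF h] that by (auto simp: inj_on_eq_iff)
  have h_S: "h i \<in> S" if "i < d" for i
    using bij_betw_apply[OF h] that by auto
  define T where "T x = {i. i < d \<and> (x ! i) \<noteq> (v ! i)}" for x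
  define F where "F x = vec n (W \<union> h ` T x)" for x
  have T_sub: "T x \<subseteq> {..<d}" for x
    by (auto simp: T_def)
  have hT_S: "h ` T x \<subseteq> S" for x
    using h_S by (auto simp: T_def)
  have T_inj: "x = y" if "length x = d" "length y = d" "T x = T y" for x y
  proof (rule nth_equalityI)
    fix i assume "i < length x"
    moreover have "i \<in> T x \<longleftrightarrow> i \<in> T y"
      using that(3) by simp
    ultimately show "x ! i = y ! i"
      using that(1) by (auto simp: T_def)
  qed (simp add: that)
  have F_inj: "inj_on F {x. length x = d}"
  proof (rule inj_onI)
    fix x y assume xy: "x \<in> {x. length x = d}" "y \<in> {x. length x = d}" "F x = F y"
    have sub: "(W \<union> h ` T z) \<inter> {..<n} = W \<union> h ` T z" for z
      using W(1) hT_S[of z] S(1) by blast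
    have "W \<union> h ` T x = W \<union> h ` T y"
      using xy(3) unfolding F_def vec_eq_iff sub .
    then have "h ` T x = h ` T y"
      using hT_S[of x] hT_S[of y] W(2) by blast
    then have "T x = T y"
      using inj_on_image_eq_iff[OF bij_betw_imp_inj_on[OF h] T_sub T_sub] by simp
    then show "x = y"
      using T_inj xy by simp
  qed
  have canon: "F ` {x, y} = cedge n (insert (h i) (W \<union> h ` T x)) (h i) \<and>
      h i \<in> S \<and> insert (h i) (W \<union> h ` T x) \<subseteq> {..<n} \<and> insert (h i) (W \<union> h ` T x) - S = W \<and>
      (x \<noteq> v \<longrightarrow> insert (h i) (W \<union> h ` T x) - {h i} \<noteq> W)"
    if x: "length x = d" and i: "i < d" "i \<notin> T x" and Ty: "T y = insert i (T x)" for x y i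
  proof -
    have "h i \<notin> h ` T x"
      using i h_inj T_sub[of x] by auto
    moreover have "h i \<notin> W"
      using h_S[OF i(1)] W(2) by blast
    ultimately have del: "insert (h i) (W \<union> h ` T x) - {h i} = W \<union> h ` T x"
      by simp
    have "F ` {x, y} = cedge n (insert (h i) (W \<union> h ` T x)) (h i)"
      unfolding cedge_def del by (simp add: F_def Ty)
    moreover have "W \<union> h ` T x \<noteq> W" if "x \<noteq> v"
    proof -
      have "T v = {}"
        by (simp add: T_def)
      then have "T x \<noteq> {}"
        using T_inj[OF x v] that by metis
      then obtain j where "j \<in> T x"
        by blast
      then have "h j \<in> h ` T x" "h j \<notin> W"
        using h_S[of j] T_sub[of x] W(2) by auto
      then show ?thesis
        by auto
    qed
    moreover have "insert (h i) (W \<union> h ` T x) \<subseteq> {..<n}"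
      using h_S[OF i(1)] hT_S[of x] S(1) W(1) by auto
    moreover have "insert (h i) (W \<union> h ` T x) - S = W"
      using h_S[OF i(1)] hT_S[of x] W(2) by auto
    ultimately show ?thesis
      using h_S[OF i(1)] del by simp
  qed
  have F_edge: "\<exists>Z p. F ` e = cedge n Z p \<and> p \<in> S \<and> p \<in> Z \<and> Z \<subseteq> {..<n} \<and> Z - S = W \<and>
      (v \<notin> e \<longrightarrow> Z - {p} \<noteq> W)" if e: "e \<in> edges (hypercube d)" for e
  proof -
    obtain Z0 i where Z0: "i \<in> Z0" "Z0 \<subseteq> {..<d}" "e = cedge d Z0 i"
      using e by (rule edge_hypercubeE)
    define a where "a = vec d (Z0 - {i})"
    define b where "b = vec d Z0"
    have ab: "e = {a, b}" "length a = d" "length b = d"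
      by (simp_all add: Z0(3) cedge_def a_def b_def)
    have i: "i < d"
      using Z0 by auto
    have same: "b ! j = a ! j" if "j < d" "j \<noteq> i" for j
      using that by (simp add: a_def b_def vec_def)
    have diff: "b ! i \<noteq> a ! i"
      using i Z0(1) by (simp add: a_def b_def vec_def)
    show ?thesis
    \<comment> \<open>Reflection by \<open>v\<close> may exchange the upper and the lower endpoint
      of the edge.\<close>
    proof (cases "i \<in> T a")
      case True
      have "T a = insert i (T b)" "i \<notin> T b"
        using True same diff i by (auto simp: T_def)
      from canon[OF ab(3) i this(2,1)] show ?thesis
        by (intro exI[of _ "insert (h i) (W \<union> h ` T b)"] exI[of _ "h i"])
          (auto simp: ab(1) insert_commute)
    next
      case False
      have "T b = insert i (T a)"
        using False same diff i by (auto simp: T_def)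
      from canon[OF ab(2) i False this] show ?thesis
        by (intro exI[of _ "insert (h i) (W \<union> h ` T a)"] exI[of _ "h i"]) (auto simp: ab(1))
    qed
  qed
  have F_inj': "inj_on F (verts G)"
    using F_inj by (rule inj_on_subset) (use verts verts_hypercube in blast)
  have G_edge: "e \<subseteq> verts G" "card e = 2" if "e \<in> edges G" for e
    using simple that by (auto simp: simple_graph_def)
  define H where "H = \<lparr>verts = F ` verts G, edges = (`) F ` edges G\<rparr>"
  have H_sel: "verts H = F ` verts G" "edges H = (`) F ` edges G"
    by (simp_all add: H_def)
  have "simple_graph H"
    unfolding simple_graph_def H_sel
  proof
    fix e assume "e \<in> (`) F ` edges G"
    then obtain e' where e': "e' \<in> edges G" "e = F ` e'"
      by blast
    then show "e \<subseteq> F ` verts G \<and> card e = 2"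
      using G_edge[OF e'(1)] card_image[OF inj_on_subset[OF F_inj' G_edge(1)[OF e'(1)]]]
      by (simp add: image_mono)
  qed
  moreover have "verts H \<subseteq> verts (hypercube n)"
    by (auto simp: H_sel verts_hypercube F_def)
  moreover have "edges H \<subseteq> edges (hypercube n)"
  proof
    fix e assume "e \<in> edges H"
    then obtain e' where e': "e' \<in> edges G" "e = F ` e'"
      by (auto simp: H_sel)
    then obtain Z p where "e = cedge n Z p" "p \<in> Z" "Z \<subseteq> {..<n}"
      using F_edge[OF subsetD[OF edges e'(1)]] by metis
    then show "e \<in> edges (hypercube n)"
      using cedge_in_hypercube by simp
  qed
  moreover have "isomorphic G H"
    unfolding isomorphic_def
  proof (intro exI[of _ F] conjI ballI)
    show "bij_betw F (verts G) (verts H)"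
      using F_inj' by (simp add: bij_betw_def H_sel)
    fix x y assume xy: "x \<in> verts G" "y \<in> verts G"
    have image: "{F x, F y} = F ` {x, y}"
      by simp
    show "{x, y} \<in> edges G \<longleftrightarrow> {F x, F y} \<in> edges H"
    proof
      assume "{F x, F y} \<in> edges H"
      then obtain e where e: "e \<in> edges G" "F ` {x, y} = F ` e"
        unfolding image H_sel by blast
      have "{x, y} = e"
        using inj_on_image_eq_iff[OF F_inj', of "{x, y}" e] e(2) xy G_edge(1)[OF e(1)] by simp
      then show "{x, y} \<in> edges G"
        using e(1) by simp
    qed (simp only: image H_sel imageI)
  qed
  ultimately have "embedding G n H"
    by (simp add: embedding_def subgraph_def)
  moreover have "\<exists>Z p. e = cedge n Z p \<and> p \<in> S \<and> p \<in> Z \<and> Z \<subseteq> {..<n} \<and> Z - S = W \<and>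
      ((\<forall>e\<in>edges G. v \<notin> e) \<longrightarrow> Z - {p} \<noteq> W)" if e: "e \<in> edges H" for e
  proof -
    obtain e' where e': "e' \<in> edges G" "e = F ` e'"
      using e by (auto simp: H_sel)
    then have "e' \<in> edges (hypercube d)"
      using edges by blast
    from F_edge[OF this] show ?thesis
      using e' by metis
  qed
  ultimately show ?thesis
    by (intro exI[of _ H] conjI ballI)
qed

text \<open>\<open>J x\<close> is the length of a longest nondecreasing sequence of misses with values at most \<open>x\<close>.\<close>

lemma monotone_hitting_index:
  fixes hit :: "nat \<Rightarrow> nat \<Rightarrow> bool"
  assumes seq: "\<And>l. \<lbrakk>\<forall>j<d. l j \<le> L; \<forall>i j. i \<le> j \<longrightarrow> j < d \<longrightarrow> l i \<le> l j\<rbrakk> \<Longrightarrow> \<exists>j<d. hit j (l j)"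
  shows "\<exists>J. (\<forall>x\<le>L. J x < d \<and> hit (J x) x) \<and> (\<forall>x y. x \<le> y \<longrightarrow> y \<le> L \<longrightarrow> J x \<le> J y)"
proof -
  define bad where "bad x m \<longleftrightarrow> (\<exists>l. (\<forall>j<m. l j \<le> x \<and> \<not> hit j (l j)) \<and> (\<forall>i j. i \<le> j \<longrightarrow> j < m \<longrightarrow> l i \<le> l j))"
    for x m :: nat
  define J where "J x = Max {m. m \<le> d \<and> bad x m}" for x
  have fin: "finite {m. m \<le> d \<and> bad x m}" for x
    by simp
  have "bad x 0" for x
    by (simp add: bad_def)
  then have "{m. m \<le> d \<and> bad x m} \<noteq> {}" for x
    by blast
  then have "J x \<in> {m. m \<le> d \<and> bad x m}" for x
    unfolding J_def by (rule Max_in[OF fin])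
  then have J: "J x \<le> d" "bad x (J x)" for x
    by auto
  have J_ge: "m \<le> J x" if "m \<le> d" "bad x m" for m x
    unfolding J_def using that by (intro Max_ge) auto
  have not_bad: "\<not> bad x d" if "x \<le> L" for x
  proof
    assume "bad x d"
    then obtain l where l: "\<forall>j<d. l j \<le> x \<and> \<not> hit j (l j)" "\<forall>i j. i \<le> j \<longrightarrow> j < d \<longrightarrow> l i \<le> l j"
      unfolding bad_def by blast
    have "\<forall>j<d. l j \<le> L"
      using l(1) \<open>x \<le> L\<close> by (meson order_trans)
    from seq[OF this l(2)] show False
      using l(1) by blast
  qed
  have J_less: "J x < d" if "x \<le> L" for x
    using J[of x] not_bad[OF that] by (metis le_neq_implies_less)
  have hit_J: "hit (J x) x" if "x \<le> L" for x
  proof (rule ccontr)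
    assume no: "\<not> hit (J x) x"
    obtain l where l: "\<forall>j<J x. l j \<le> x \<and> \<not> hit j (l j)" "\<forall>i j. i \<le> j \<longrightarrow> j < J x \<longrightarrow> l i \<le> l j"
      using J(2)[of x] unfolding bad_def by blast
    \<comment> \<open>If the star \<open>J x\<close> missed at \<open>x\<close>, appending
      \<open>x\<close> would give a longer nondecreasing sequence of misses, as all earlier values
      are at most \<open>x\<close>.\<close>
    have "bad x (Suc (J x))"
      unfolding bad_def using l no by (intro exI[of _ "l(J x := x)"]) (auto simp: less_Suc_eq)
    then show False
      using J_ge[of "Suc (J x)" x] J_less[OF that] by simp
  qed
  have mono_J: "J x \<le> J y" if "x \<le> y" for x y
  proof (rule J_ge)
    show "J x \<le> d"
      by (rule J(1))
    show "bad y (J x)"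
    proof -
      obtain l where l: "\<forall>j<J x. l j \<le> x \<and> \<not> hit j (l j)" "\<forall>i j. i \<le> j \<longrightarrow> j < J x \<longrightarrow> l i \<le> l j"
        using J(2)[of x] unfolding bad_def by blast
      have "\<forall>j<J x. l j \<le> y \<and> \<not> hit j (l j)"
        using l(1) that le_trans by blast
      then show ?thesis
        unfolding bad_def using l(2) by (intro exI[of _ l] conjI)
    qed
  qed
  show ?thesis
    by (intro exI[of _ J] conjI allI impI J_less hit_J mono_J)
qed

text \<open>Here \<open>l j\<close> counts the fixed ones left of star \<open>j\<close>, and a cell
  records the number of free ones and the number of ones left of the star. Each colour assigns one
  of its own cells to each of \<open>L + 1\<close> values \<open>x\<close>. Every cell has a single
  colour, so bounding how many values share a cell and summing over all cells gives the
  inequality.\<close>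

lemma level_counting:
  fixes \<chi> :: "nat \<Rightarrow> nat \<Rightarrow> nat"
  assumes off: "off \<subseteq> {..<d}"
    and seq: "\<And>c l. \<lbrakk>c < K; \<forall>j<d. l j \<le> L; \<forall>i j. i \<le> j \<longrightarrow> j < d \<longrightarrow> l i \<le> l j\<rbrakk> \<Longrightarrow>
           \<exists>j<d. \<exists>\<alpha> \<beta>. \<alpha> \<le> j \<and> \<beta> \<le> d - 1 - j \<and> \<alpha> + \<beta> \<in> off \<and> \<chi> (\<alpha> + \<beta>) (l j + \<alpha>) = c"
  shows "K * (L + 1) \<le> (\<Sum>i\<in>off. min (min (i + 1) (d - i)) ((d + 1) div 2)) * (L + d)"
proof -
  define m where "m i = min (min (i + 1) (d - i)) ((d + 1) div 2)" for i
  have fin: "finite off"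
    using off finite_subset by blast
  define cells where "cells c = {z \<in> off \<times> {..<L + d}. \<chi> (fst z) (snd z) = c}" for c
  have fin_cells: "finite (cells c)" for c
    using fin by (simp add: cells_def)
  have colour_count: "L + 1 \<le> (\<Sum>z\<in>cells c. m (fst z))" if c: "c < K" for c
  proof -
    define hit where "hit j x \<longleftrightarrow> (\<exists>\<alpha> \<beta>. \<alpha> \<le> j \<and> \<beta> \<le> d - 1 - j \<and> \<alpha> + \<beta> \<in> off \<and> \<chi> (\<alpha> + \<beta>) (x + \<alpha>) = c)"
      for j x
    obtain J where J: "\<And>x. x \<le> L \<Longrightarrow> J x < d \<and> hit (J x) x" and mono: "\<And>x y. \<lbrakk>x \<le> y; y \<le> L\<rbrakk> \<Longrightarrow> J x \<le> J y"
      using monotone_hitting_index[of d L hit] seq[OF c] unfolding hit_def by blast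
    obtain \<alpha> \<beta> where ab: "\<And>x. x \<le> L \<Longrightarrow> \<alpha> x \<le> J x \<and> \<beta> x \<le> d - 1 - J x \<and> \<alpha> x + \<beta> x \<in> off \<and>
        \<chi> (\<alpha> x + \<beta> x) (x + \<alpha> x) = c"
      using J unfolding hit_def by metis
    define X where "X z = {x. x \<le> L \<and> (\<alpha> x + \<beta> x, x + \<alpha> x) = z}" for z
    have "{..L} \<subseteq> (\<Union>z\<in>cells c. X z)"
    proof
      fix x assume "x \<in> {..L}"
      then have x: "x \<le> L"
        by simp
      have "x + \<alpha> x < L + d"
        using ab[OF x] J[OF x] x by linarith
      then have "(\<alpha> x + \<beta> x, x + \<alpha> x) \<in> cells c"
        using ab[OF x] by (simp add: cells_def)
      moreover have "x \<in> X (\<alpha> x + \<beta> x, x + \<alpha> x)"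
        using x by (simp add: X_def)
      ultimately show "x \<in> (\<Union>z\<in>cells c. X z)"
        by blast
    qed
    moreover have fin_X: "finite (X z)" for z
      by (rule finite_subset[of _ "{..L}"]) (auto simp: X_def)
    ultimately have "card {..L} \<le> card (\<Union>z\<in>cells c. X z)"
      using fin_cells by (intro card_mono) auto
    also have "\<dots> \<le> (\<Sum>z\<in>cells c. card (X z))"
      by (rule card_UN_le[OF fin_cells])
    also have "\<dots> \<le> (\<Sum>z\<in>cells c. m (fst z))"
    proof (rule sum_mono)
      fix z
      show "card (X z) \<le> m (fst z)"
      proof (cases "X z = {}")
        case False
        define x where "x = Min (X z)"
        have x: "x \<in> X z"
          using False fin_X by (simp add: x_def)
        \<comment> \<open>Let \<open>x \<le> y\<close> share a cell with \<open>i\<close> free ones.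
          Then \<open>y - x = \<alpha> x - \<alpha> y = \<beta> y - \<beta> x\<close>, where
          \<open>\<alpha> x \<le> J x \<le> J y\<close> and
          \<open>\<beta> y \<le> d - 1 - J y\<close>. Hence \<open>y - x \<le> i\<close>,
          \<open>y - x \<le> d - 1 - i\<close> and \<open>2 * (y - x) \<le> d - 1\<close>, which are
          the three terms of \<open>m\<close>.\<close>
        have "X z \<subseteq> {x..<x + m (fst z)}"
        proof
          fix y assume y: "y \<in> X z"
          have le: "x \<le> y"
            using y fin_X by (simp add: x_def)
          have xL: "x \<le> L" and yL: "y \<le> L" and fz: "fst z = \<alpha> x + \<beta> x" "fst z = \<alpha> y + \<beta> y"
            and sz: "x + \<alpha> x = y + \<alpha> y"
            using x y by (auto simp: X_def)
          have "J x \<le> J y"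
            using mono[OF le yL] .
          then show "y \<in> {x..<x + m (fst z)}"
            using ab[OF xL] ab[OF yL] J[OF xL] J[OF yL] le fz sz unfolding m_def by (auto simp: min_def)
        qed
        then show ?thesis
          using card_mono[of "{x..<x + m (fst z)}"] by simp
      qed simp
    qed
    finally show ?thesis
      by simp
  qed
  have "K * (L + 1) = (\<Sum>c<K. L + 1)"
    by simp
  also have "\<dots> \<le> (\<Sum>c<K. \<Sum>z\<in>cells c. m (fst z))"
    using colour_count by (intro sum_mono) simp
  also have "\<dots> = (\<Sum>z\<in>(\<Union>c<K. cells c). m (fst z))"
    using fin_cells by (intro sum.UNION_disjoint[symmetric]) (auto simp: cells_def)
  also have "\<dots> \<le> (\<Sum>z\<in>off \<times> {..<L + d}. m (fst z))"
    using fin by (intro sum_mono2) (auto simp: cells_def)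
  also have "\<dots> = (\<Sum>i\<in>off. (L + d) * m i)"
    by (simp add: sum.cartesian_product')
  also have "\<dots> = (\<Sum>i\<in>off. m i) * (L + d)"
    by (subst sum_distrib_left[symmetric]) (rule mult.commute)
  finally show ?thesis
    by (simp add: m_def)
qed

text \<open>The terms climb from 1 to \<open>k\<close> and descend from \<open>k\<close> to 1, so
  the sum is twice a triangular number; a reflection matches the halves.\<close>

lemma sum_trapezoid:
  fixes k :: nat
  shows "(\<Sum>i<2 * k. min (min (i + 1) (2 * k - i)) ((2 * k + 1) div 2)) = k\<^sup>2 + k"
proof -
  let ?m = "\<lambda>i. min (min (i + 1) (2 * k - i)) ((2 * k + 1) div 2)"
  have low: "(\<Sum>i<k. ?m i) = (\<Sum>i<k. i + 1)"
    by (rule sum.cong) auto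
  have "(\<Sum>i=k..<2 * k. ?m i) = (\<Sum>i=k..<2 * k. 2 * k - i)"
    by (rule sum.cong) auto
  also have "\<dots> = (\<Sum>i<k. i + 1)"
    by (rule sum.reindex_bij_witness[of _ "\<lambda>i. 2 * k - 1 - i" "\<lambda>i. 2 * k - 1 - i"]) auto
  finally have high: "(\<Sum>i=k..<2 * k. ?m i) = (\<Sum>i<k. i + 1)" .
  have "(\<Sum>i<2 * k. ?m i) = (\<Sum>i<k. ?m i) + (\<Sum>i=k..<2 * k. ?m i)"
    unfolding lessThan_atLeast0 by (rule sum.atLeastLessThan_concat[symmetric]) simp_all
  also have "\<dots> = 2 * (\<Sum>i<k. i + 1)"
    unfolding low high by simp
  also have "\<dots> = k\<^sup>2 + k"
    by (induction k) (auto simp: power2_eq_square)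
  finally show ?thesis .
qed

section \<open>From polychromatic colourings to the counting inequality\<close>

definition colourable :: "'a ugraph \<Rightarrow> nat \<Rightarrow> bool" where
  "colourable G r \<longleftrightarrow> (\<forall>n\<ge>1. (\<exists>H. embedding G n H) \<longrightarrow> (\<exists>c. polychromatic_coloring G r n c))"

lemma rank_inject:
  fixes Z :: "nat set"
  assumes "finite Z" "p \<in> Z" "p' \<in> Z" "card {q \<in> Z. q < p} = card {q \<in> Z. q < p'}"
  shows "p = p'"
proof -
  have "card {q \<in> Z. q < a} < card {q \<in> Z. q < b}" if "a \<in> Z" "a < b" for a b
    by (rule card_less_if_witness[where a = a]) (use assms(1) that in auto)
  from this[of p p'] this[of p' p] show ?thesis
    using assms by (cases p p' rule: linorder_cases) simp_all
qed

text \<open>Among the edges with all their ones in a Ramsey-homogeneous set \<open>Y\<close>, the colour depends only on the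
  number of ones and on the number of ones to the left of the flipped coordinate.\<close>

lemma ex_homogeneous_set:
  fixes r M :: nat
  shows "\<exists>N. \<forall>c. (\<forall>e\<in>edges (hypercube N). c e < r) \<longrightarrow>
     (\<exists>Y\<subseteq>{..<N}. card Y = M \<and>
       (\<exists>\<chi>. \<forall>Z p. Z \<subseteq> Y \<longrightarrow> p \<in> Z \<longrightarrow> c (cedge N Z p) = \<chi> (card Z) (card {q \<in> Z. q < p})))"
proof -
  have "finite (Pow ({..<Suc M} \<times> {..<r}))"
    by simp
  from ramsey_all_sizes[OF this, of M "Suc M"]
  obtain N :: nat where N: "\<forall>f. (\<forall>Z\<subseteq>{..<N}. f Z \<in> Pow ({..<Suc M} \<times> {..<r})) \<longrightarrow>
      (\<exists>Y\<subseteq>{..<N}. card Y = M \<and>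
        (\<forall>Z Z'. Z \<subseteq> Y \<and> Z' \<subseteq> Y \<and> card Z = card Z' \<and> card Z < Suc M \<longrightarrow> f Z = f Z'))"
    by blast
  have "\<exists>Y\<subseteq>{..<N}. card Y = M \<and>
       (\<exists>\<chi>. \<forall>Z p. Z \<subseteq> Y \<longrightarrow> p \<in> Z \<longrightarrow> c (cedge N Z p) = \<chi> (card Z) (card {q \<in> Z. q < p}))"
    if c: "\<forall>e\<in>edges (hypercube N). c e < r" for c
  proof -
    \<comment> \<open>The Ramsey colour of \<open>Z\<close> is the whole table of ranks and edge
      colours for the directions in \<open>Z\<close>. Cutting off ranks above \<open>M\<close> keeps
      the set of possible tables finite even for large \<open>Z\<close>.\<close>
    define f where "f Z = {(card {q \<in> Z. q < p}, c (cedge N Z p)) | p. p \<in> Z \<and> card {q \<in> Z. q < p} < Suc M}" for Z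
    have f: "f Z \<in> Pow ({..<Suc M} \<times> {..<r})" if "Z \<subseteq> {..<N}" for Z
    proof -
      have "c (cedge N Z p) < r" if "p \<in> Z" for p
        using c cedge_in_hypercube[OF that \<open>Z \<subseteq> {..<N}\<close>] by blast
      then show ?thesis
        by (auto simp: f_def)
    qed
    have "\<exists>Y\<subseteq>{..<N}. card Y = M \<and>
        (\<forall>Z Z'. Z \<subseteq> Y \<and> Z' \<subseteq> Y \<and> card Z = card Z' \<and> card Z < Suc M \<longrightarrow> f Z = f Z')"
      using spec[OF N, of f] f by blast
    then obtain Y where Y: "Y \<subseteq> {..<N}" "card Y = M"
      and hom0: "\<forall>Z Z'. Z \<subseteq> Y \<and> Z' \<subseteq> Y \<and> card Z = card Z' \<and> card Z < Suc M \<longrightarrow> f Z = f Z'"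
      by (elim exE conjE) (rule that)
    have hom: "f Z = f Z'" if "Z \<subseteq> Y" "Z' \<subseteq> Y" "card Z = card Z'" "card Z < Suc M" for Z Z'
      by (intro hom0[rule_format] conjI that)
    have finY: "finite Y"
      using Y(1) finite_subset by blast
    have same: "c (cedge N Z p) = c (cedge N Z' p')"
      if Z: "Z \<subseteq> Y" "p \<in> Z" and Z': "Z' \<subseteq> Y" "p' \<in> Z'" and eq: "card Z = card Z'"
        "card {q \<in> Z. q < p} = card {q \<in> Z'. q < p'}" for Z p Z' p'
    proof -
      have fin: "finite Z" "finite Z'"
        using Z(1) Z'(1) finY finite_subset by blast+
      have "card Z \<le> M"
        using card_mono[OF finY Z(1)] Y(2) by simp
      moreover have "card {q \<in> Z. q < p} \<le> card Z"
        using fin by (intro card_mono) auto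
      ultimately have small: "card Z < Suc M" "card {q \<in> Z. q < p} < Suc M"
        by linarith+
      have "(card {q \<in> Z. q < p}, c (cedge N Z p)) \<in> f Z"
        unfolding f_def using Z(2) small(2) by blast
      also have "f Z = f Z'"
        using hom[OF Z(1) Z'(1) eq(1) small(1)] .
      finally obtain p'' where p'': "p'' \<in> Z'" "card {q \<in> Z. q < p} = card {q \<in> Z'. q < p''}"
        "c (cedge N Z p) = c (cedge N Z' p'')"
        unfolding f_def by blast
      have "p'' = p'"
        using rank_inject[OF fin(2) p''(1) Z'(2)] p''(2) eq(2) by simp
      then show ?thesis
        using p''(3) by simp
    qed
    define \<chi> where "\<chi> s x = (SOME a. \<exists>Z p. Z \<subseteq> Y \<and> p \<in> Z \<and> card Z = s \<and> card {q \<in> Z. q < p} = x \<and> a = c (cedge N Z p))"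
      for s x
    have "c (cedge N Z p) = \<chi> (card Z) (card {q \<in> Z. q < p})" if Z: "Z \<subseteq> Y" "p \<in> Z" for Z p
    proof -
      have "\<exists>a Z' p'. Z' \<subseteq> Y \<and> p' \<in> Z' \<and> card Z' = card Z \<and> card {q \<in> Z'. q < p'} = card {q \<in> Z. q < p} \<and>
          a = c (cedge N Z' p')"
        using Z by blast
      from someI_ex[OF this] obtain Z' p' where "Z' \<subseteq> Y" "p' \<in> Z'" "card Z' = card Z"
        "card {q \<in> Z'. q < p'} = card {q \<in> Z. q < p}" "\<chi> (card Z) (card {q \<in> Z. q < p}) = c (cedge N Z' p')"
        unfolding \<chi>_def by blast
      then show ?thesis
        using same[OF Z] by metis
    qed
    then show ?thesis
      using Y by (intro exI[of _ Y] exI[of _ \<chi>] conjI allI impI)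
  qed
  then show ?thesis
    by (intro exI[of _ N] allI impI)
qed

lemma ex_increasing_enumeration:
  fixes Y :: "nat set"
  assumes "finite Y"
  shows "\<exists>y. y ` {..<card Y} = Y \<and> (\<forall>i j. i < j \<longrightarrow> j < card Y \<longrightarrow> y i < y j)"
proof -
  let ?y = "\<lambda>i. sorted_list_of_set Y ! i"
  have "?y ` {..<card Y} = set (sorted_list_of_set Y)"
    using assms by (auto simp: set_conv_nth)
  moreover have "\<forall>i j. i < j \<longrightarrow> j < card Y \<longrightarrow> ?y i < ?y j"
    using assms by (auto intro: sorted_wrt_nth_less[OF strict_sorted_list_of_set])
  ultimately show ?thesis
    using assms by (intro exI[of _ ?y]) simp
qed

lemma card_below_enumerated:
  fixes y :: "nat \<Rightarrow> nat"
  assumes mono: "\<And>i j. \<lbrakk>i < j; j < m\<rbrakk> \<Longrightarrow> y i < y j" and k: "k < m"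
  shows "card {q \<in> y ` {..<m}. q < y k} = k"
proof -
  have less_iff: "y i < y k \<longleftrightarrow> i < k" if "i < m" for i
    using mono[of i k] mono[of k i] k that by (cases i k rule: linorder_cases) auto
  have "{q \<in> y ` {..<m}. q < y k} = y ` {..<k}"
    using less_iff k by auto
  moreover have "inj_on y {..<k}"
  proof (rule inj_onI)
    fix i j assume "i \<in> {..<k}" "j \<in> {..<k}" "y i = y j"
    then show "i = j"
      using mono[of i j] mono[of j i] k by (cases i j rule: linorder_cases) auto
  qed
  ultimately show ?thesis
    by (simp add: card_image)
qed

text \<open>Every nondecreasing \<open>l\<close> is realised by a choice of \<open>d\<close> stars
  among the \<open>L + d\<close> points of a homogeneous set \<open>Y\<close>, the other
  \<open>L\<close> points being the fixed ones. The resulting copy of \<open>G\<close> shows every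
  colour, which is the hypothesis of \<open>level_counting\<close>. If no edge meets
  \<open>v\<close>, \<open>off\<close> omits 0 because \<open>v\<close> is placed at the bottom
  vertex.\<close>

lemma colourable_bound:
  assumes simple: "simple_graph G" and verts: "verts G \<subseteq> verts (hypercube d)"
    and edges: "edges G \<subseteq> edges (hypercube d)" and v: "length v = d" and d: "d \<ge> 1"
    and off: "off = (if \<forall>e\<in>edges G. v \<notin> e then {1..<d} else {..<d})"
    and col: "colourable G r"
  shows "r * (L + 1) \<le> (\<Sum>i\<in>off. min (min (i + 1) (d - i)) ((d + 1) div 2)) * (L + d)"
proof -
  note embed = cube_embedding[OF simple verts edges v]
  obtain N where N: "\<And>c. \<forall>e\<in>edges (hypercube N). c e < r \<Longrightarrow>
     \<exists>Y\<subseteq>{..<N}. card Y = L + d \<and>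
       (\<exists>\<chi>. \<forall>Z p. Z \<subseteq> Y \<longrightarrow> p \<in> Z \<longrightarrow> c (cedge N Z p) = \<chi> (card Z) (card {q \<in> Z. q < p}))"
    using ex_homogeneous_set[of r "L + d"] by blast
  show ?thesis
  proof (cases "r = 0")
    case False
    \<comment> \<open>The constant colouring serves to read off \<open>d \<le> N\<close>, so that
      \<open>G\<close> embeds and a polychromatic colouring exists.\<close>
    then obtain Y0 where "Y0 \<subseteq> {..<N}" "card Y0 = L + d"
      using N[of "\<lambda>_. 0"] by auto
    then have "d \<le> N"
      using card_mono[of "{..<N}" Y0] by simp
    then have "\<exists>H. embedding G N H"
      using embed[of "{..<d}" N "{}"] by auto
    then obtain c where c: "polychromatic_coloring G r N c"
      using col d \<open>d \<le> N\<close> unfolding colourable_def by (meson order_trans)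
    then obtain Y \<chi> where Y: "Y \<subseteq> {..<N}" "card Y = L + d"
      and \<chi>: "\<And>Z p. \<lbrakk>Z \<subseteq> Y; p \<in> Z\<rbrakk> \<Longrightarrow> c (cedge N Z p) = \<chi> (card Z) (card {q \<in> Z. q < p})"
      using N[of c] unfolding polychromatic_coloring_def by metis
    have finY: "finite Y"
      using Y(1) finite_subset by blast
    obtain y where y_im: "y ` {..<L + d} = Y" and y_mono: "\<And>i j. \<lbrakk>i < j; j < L + d\<rbrakk> \<Longrightarrow> y i < y j"
      using ex_increasing_enumeration[OF finY] unfolding Y(2) by metis
    show ?thesis
    \<comment> \<open>The set \<open>Z\<close> of an edge also contains the flipped coordinate,
      hence the \<open>+ 1\<close> in the number of ones.\<close>
    proof (rule level_counting[where \<chi> = "\<lambda>i. \<chi> (L + i + 1)"])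
      show "off \<subseteq> {..<d}"
        by (auto simp: off)
      fix a l assume a: "a < r" and l: "\<forall>j<d. l j \<le> L" "\<forall>i j. i \<le> j \<longrightarrow> j < d \<longrightarrow> l i \<le> l j"
      \<comment> \<open>Star \<open>j\<close> is preceded in \<open>Y\<close> by \<open>l j\<close>
        fixed ones and by \<open>j\<close> earlier stars.\<close>
      define s where "s j = y (l j + j)" for j
      have idx: "l j + j < L + d" if "j < d" for j
        using l(1) that by (meson add_le_less_mono)
      have s_mono: "s i < s j" if "i < j" "j < d" for i j
        unfolding s_def using l(2) that idx by (intro y_mono) (auto intro!: add_le_less_mono)
      define S where "S = s ` {..<d}"
      have S_Y: "S \<subseteq> Y"
        using idx y_im by (auto simp: S_def s_def)
      have s_inj: "inj_on s {..<d}"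
      proof (rule inj_onI)
        fix i j assume "i \<in> {..<d}" "j \<in> {..<d}" "s i = s j"
        then show "i = j"
          using s_mono[of i j] s_mono[of j i] by (cases i j rule: linorder_cases) auto
      qed
      have card_S: "card S = d"
        using s_inj by (simp add: S_def card_image)
      have finS: "finite S"
        by (simp add: S_def)
      have S_N: "S \<subseteq> {..<N}" and W_N: "Y - S \<subseteq> {..<N}"
        using S_Y Y(1) by auto
      have "(Y - S) \<inter> S = {}"
        by blast
      from embed[OF S_N card_S W_N this]
      obtain H where H: "embedding G N H"
        and H_edge: "\<forall>e\<in>edges H. \<exists>Z p. e = cedge N Z p \<and> p \<in> S \<and> p \<in> Z \<and> Z \<subseteq> {..<N} \<and> Z - S = Y - S \<and>
              ((\<forall>e\<in>edges G. v \<notin> e) \<longrightarrow> Z - {p} \<noteq> Y - S)"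
        by (elim exE conjE) (rule that)
      obtain e where e: "e \<in> edges H" "c e = a"
        using c H a unfolding polychromatic_coloring_def by metis
      obtain Z p where Zp: "e = cedge N Z p" "p \<in> S" "p \<in> Z" "Z - S = Y - S"
        and bottom: "(\<forall>e\<in>edges G. v \<notin> e) \<longrightarrow> Z - {p} \<noteq> Y - S"
        using bspec[OF H_edge e(1)] by (elim exE conjE) (rule that)
      have Z_Y: "Z \<subseteq> Y"
        using Zp(4) S_Y by blast
      obtain j where j: "j < d" "p = s j"
        using Zp(2) by (auto simp: S_def)
      have S_below: "card {q \<in> S. q < p} = j"
        unfolding S_def j(2) by (rule card_below_enumerated[OF s_mono j(1)])
      have S_above: "card {q \<in> S. p < q} = d - 1 - j"
        using card_below_above[OF finS Zp(2)] S_below card_S by linarith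
      have Y_below: "card {q \<in> Y. q < p} = l j + j"
        unfolding y_im[symmetric] j(2) s_def by (rule card_below_enumerated[OF y_mono idx[OF j(1)]])
      define A where "A = {q \<in> Z \<inter> S. q < p}"
      define B where "B = {q \<in> Z \<inter> S. p < q}"
      have finAB: "finite A" "finite B"
        using finS by (auto simp: A_def B_def)
      have "card A \<le> j"
        unfolding S_below[symmetric] using finS by (intro card_mono) (auto simp: A_def)
      moreover have "card B \<le> d - 1 - j"
        unfolding S_above[symmetric] using finS by (intro card_mono) (auto simp: B_def)
      moreover
      have Z_eq: "Z = (Y - S) \<union> insert p (A \<union> B)"
      proof -
        have "Z \<inter> S = insert p (A \<union> B)"
          using Zp(2,3) by (auto simp: A_def B_def)
        then show ?thesis
          unfolding Zp(4)[symmetric] by blast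
      qed
      have card_Z: "card Z = L + (card A + card B) + 1"
      proof -
        have "card Z = card (Y - S) + card (insert p (A \<union> B))"
          unfolding Z_eq using finY finAB Zp(2) by (intro card_Un_disjoint) (auto simp: A_def B_def)
        also have "card (insert p (A \<union> B)) = Suc (card (A \<union> B))"
          using finAB by (intro card_insert_disjoint) (auto simp: A_def B_def)
        also have "card (A \<union> B) = card A + card B"
          using finAB by (intro card_Un_disjoint) (auto simp: A_def B_def)
        also have "card (Y - S) = L"
          using card_Diff_subset[OF finS S_Y] Y(2) card_S by simp
        finally show ?thesis
          by simp
      qed
      have Z_below: "card {q \<in> Z. q < p} = l j + card A"
      proof -
        have "{q \<in> Y. q < p} = {q \<in> Y - S. q < p} \<union> {q \<in> S. q < p}"
          using S_Y by auto
        then have "card {q \<in> Y. q < p} = card ({q \<in> Y - S. q < p} \<union> {q \<in> S. q < p})"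
          by simp
        also have "\<dots> = card {q \<in> Y - S. q < p} + card {q \<in> S. q < p}"
          using finY finS by (intro card_Un_disjoint) auto
        finally have W_below: "card {q \<in> Y - S. q < p} = l j"
          using Y_below S_below by linarith
        have "{q \<in> Z. q < p} = {q \<in> Y - S. q < p} \<union> A"
          unfolding Zp(4)[symmetric] by (auto simp: A_def)
        then have "card {q \<in> Z. q < p} = card ({q \<in> Y - S. q < p} \<union> A)"
          by simp
        also have "\<dots> = card {q \<in> Y - S. q < p} + card A"
          using finY finAB by (intro card_Un_disjoint) (auto simp: A_def)
        finally show ?thesis
          using W_below by simp
      qed
      have sum_less: "card A + card B < d"
        using \<open>card A \<le> j\<close> \<open>card B \<le> d - 1 - j\<close> j(1) by linarith
      have "card A + card B \<in> off"
      proof (cases "\<forall>e\<in>edges G. v \<notin> e")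
        case True
        \<comment> \<open>Without free ones the lower endpoint would be \<open>Y - S\<close>, the
          place of \<open>v\<close>.\<close>
        have "A \<union> B \<noteq> {}"
        proof
          assume "A \<union> B = {}"
          then have "Z - {p} = Y - S"
            unfolding Z_eq using Zp(2) by auto
          then show False
            using bottom True by blast
        qed
        then have "1 \<le> card A + card B"
          using finAB by (auto simp: Suc_le_eq card_gt_0_iff)
        moreover have "off = {1..<d}"
          unfolding off using True by (rule if_P)
        ultimately show ?thesis
          using sum_less by simp
      next
        case False
        then have "off = {..<d}"
          unfolding off by (rule if_not_P)
        then show ?thesis
          using sum_less by simp
      qed
      moreover have "\<chi> (L + (card A + card B) + 1) (l j + card A) = a"
        using \<chi>[OF Z_Y Zp(3)] e(2) unfolding Zp(1) card_Z Z_below by simp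
      ultimately show "\<exists>j<d. \<exists>\<alpha> \<beta>. \<alpha> \<le> j \<and> \<beta> \<le> d - 1 - j \<and> \<alpha> + \<beta> \<in> off \<and> \<chi> (L + (\<alpha> + \<beta>) + 1) (l j + \<alpha>) = a"
        using j(1) by blast
    qed
  qed simp
qed

subsection \<open>Polychromatic numbers\<close>

lemma colourable_if_contains_punctured_cube:
  assumes k: "k \<ge> 3" and v: "length v = 2 * k"
    and verts: "verts (hypercube (2 * k)) - {v} \<subseteq> verts G"
    and edges: "\<And>e. \<lbrakk>e \<in> edges (hypercube (2 * k)); v \<notin> e\<rbrakk> \<Longrightarrow> e \<in> edges G"
  shows "colourable G ((k - 1) * (k + 2))"
proof -
  have "polychromatic_coloring G ((k - 1) * (k + 2)) n (cube_colour k)" for n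
    unfolding polychromatic_coloring_def
  proof (intro conjI ballI allI impI)
    show "cube_colour k e < (k - 1) * (k + 2)" for e
      using cube_colour_less[OF k] .
    fix H i assume H: "embedding G n H" and i: "i < (k - 1) * (k + 2)"
    have "2 * k \<ge> 2"
      using k by simp
    have "\<exists>S W. S \<subseteq> {..<n} \<and> W \<subseteq> {..<n} \<and> card S = 2 * k \<and>
           (\<forall>Z p. p \<in> S \<longrightarrow> p \<in> Z \<longrightarrow> Z - S = W - S \<longrightarrow> Z \<noteq> W \<longrightarrow> Z - {p} \<noteq> W \<longrightarrow> cedge n Z p \<in> edges H)"
      by (rule embedding_contains_punctured_subcube[OF \<open>2 * k \<ge> 2\<close> v verts _ H]) (rule edges)
    then obtain S W where S: "S \<subseteq> {..<n}" and W: "W \<subseteq> {..<n}" and card_S: "card S = 2 * k"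
      and edge: "\<forall>Z p. p \<in> S \<longrightarrow> p \<in> Z \<longrightarrow> Z - S = W - S \<longrightarrow> Z \<noteq> W \<longrightarrow> Z - {p} \<noteq> W \<longrightarrow> cedge n Z p \<in> edges H"
      by (elim exE conjE) (rule that)
    from punctured_subcube_has_all_colours[OF k S W card_S i]
    obtain Z p where Zp: "p \<in> S" "p \<in> Z" "Z - S = W - S" "Z \<noteq> W" "Z - {p} \<noteq> W"
      and colour: "cube_colour k (cedge n Z p) = i"
      by (elim exE conjE) (rule that)
    have "cedge n Z p \<in> edges H"
      by (rule edge[rule_format, OF Zp])
    then show "\<exists>e\<in>edges H. cube_colour k e = i"
      using colour by (intro bexI[of _ "cedge n Z p"])
  qed
  then show ?thesis
    unfolding colourable_def by (intro allI impI exI[of _ "cube_colour k"])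
qed

text \<open>Divide by \<open>L\<close> and let \<open>L\<close> grow; \<open>L = M * d\<close> is
  already large enough.\<close>

lemma le_if_linear_bound:
  fixes r M d :: nat
  assumes "\<And>L. r * (L + 1) \<le> M * (L + d)"
  shows "r \<le> M"
proof (rule ccontr)
  assume "\<not> r \<le> M"
  then have "(M + 1) * (M * d + 1) \<le> r * (M * d + 1)"
    by (intro mult_right_mono) auto
  also have "\<dots> \<le> M * (M * d + d)"
    by (rule assms)
  finally show False
    by (simp add: algebra_simps)
qed

text \<open>\<open>G\<close> lies between the cube minus \<open>v\<close> and the cube, so both
  deletions are instances. If no edge meets \<open>v\<close>, the level 0 drops out of the sum and
  lowers it by one.\<close>

lemma polychromatic_number_bounds:
  assumes k: "k \<ge> 3" and v: "length v = 2 * k" and simple: "simple_graph G"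
    and verts: "verts (hypercube (2 * k)) - {v} \<subseteq> verts G" "verts G \<subseteq> verts (hypercube (2 * k))"
    and edges: "\<And>e. \<lbrakk>e \<in> edges (hypercube (2 * k)); v \<notin> e\<rbrakk> \<Longrightarrow> e \<in> edges G"
      "edges G \<subseteq> edges (hypercube (2 * k))"
  shows "k\<^sup>2 + k - 2 \<le> polychromatic_number G"
    and "polychromatic_number G \<le> k\<^sup>2 + k"
    and "\<forall>e\<in>edges G. v \<notin> e \<Longrightarrow> polychromatic_number G \<le> k\<^sup>2 + k - 1"
proof -
  let ?m = "\<lambda>i. min (min (i + 1) (2 * k - i)) ((2 * k + 1) div 2)"
  let ?off = "if \<forall>e\<in>edges G. v \<notin> e then {1..<2 * k} else {..<2 * k}"
  have k1: "2 * k \<ge> 1"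
    using k by simp
  have le_sum: "r \<le> (\<Sum>i\<in>?off. ?m i)" if "colourable G r" for r
    by (rule le_if_linear_bound) (rule colourable_bound[OF simple verts(2) edges(2) v k1 refl that])
  have sum_eq: "(\<Sum>i\<in>?off. ?m i) = (if \<forall>e\<in>edges G. v \<notin> e then k\<^sup>2 + k - 1 else k\<^sup>2 + k)"
  proof -
    have "(\<Sum>i<2 * k. ?m i) = ?m 0 + (\<Sum>i=1..<2 * k. ?m i)"
      unfolding lessThan_atLeast0 using k1 by (subst sum.atLeast_Suc_lessThan) simp_all
    moreover have "?m 0 = 1"
      using k by simp
    ultimately have "(\<Sum>i=1..<2 * k. ?m i) = k\<^sup>2 + k - 1"
      unfolding sum_trapezoid by linarith
    then show ?thesis
      using sum_trapezoid[of k] by simp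
  qed
  have bound: "r \<le> (if \<forall>e\<in>edges G. v \<notin> e then k\<^sup>2 + k - 1 else k\<^sup>2 + k)" if "colourable G r" for r
    using le_sum[OF that] unfolding sum_eq .
  have number: "polychromatic_number G = (GREATEST r. colourable G r)"
    by (simp add: polychromatic_number_def colourable_def)
  have col: "colourable G ((k - 1) * (k + 2))"
    by (rule colourable_if_contains_punctured_cube[OF k v verts(1)]) (rule edges(1))
  have "(k - 1) * (k + 2) = k\<^sup>2 + k - 2"
  proof -
    obtain j where "k = Suc j"
      using k by (cases k) auto
    then show ?thesis
      by (simp add: power2_eq_square algebra_simps)
  qed
  \<comment> \<open>By \<open>bound\<close> the admissible numbers of colours are bounded, so
    \<open>GREATEST\<close> is attained.\<close>
  moreover have "(k - 1) * (k + 2) \<le> polychromatic_number G"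
    unfolding number by (rule Greatest_le_nat[where P = "colourable G", OF col]) (rule bound)
  ultimately show "k\<^sup>2 + k - 2 \<le> polychromatic_number G"
    by simp
  have "colourable G (polychromatic_number G)"
    unfolding number by (rule GreatestI_nat[where P = "colourable G", OF col]) (rule bound)
  from bound[OF this] show "polychromatic_number G \<le> k\<^sup>2 + k"
    and "\<forall>e\<in>edges G. v \<notin> e \<Longrightarrow> polychromatic_number G \<le> k\<^sup>2 + k - 1"
    by (auto split: if_splits)
qed

theorem corollary15:
  "(\<forall>k::nat. k \<ge> 3 \<longrightarrow> (\<forall>v\<in>verts (hypercube (2 * k)).
      k^2 + k - 2 \<le> polychromatic_number (delete_vertex (hypercube (2 * k)) v) \<and>
      polychromatic_number (delete_vertex (hypercube (2 * k)) v) \<le> k^2 + k - 1)) \<and>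
   (\<forall>k::nat. k \<ge> 4 \<longrightarrow> (\<forall>e\<in>edges (hypercube (2 * k)).
      k^2 + k - 2 \<le> polychromatic_number (delete_edge (hypercube (2 * k)) e) \<and>
      polychromatic_number (delete_edge (hypercube (2 * k)) e) \<le> k^2 + k))"
proof (intro conjI allI impI ballI)
  fix k :: nat and v assume k: "k \<ge> 3" and "v \<in> verts (hypercube (2 * k))"
  then have v: "length v = 2 * k"
    by (simp add: verts_hypercube)
  define G where "G = delete_vertex (hypercube (2 * k)) v"
  have G: "verts G = verts (hypercube (2 * k)) - {v}" "edges G = {e \<in> edges (hypercube (2 * k)). v \<notin> e}"
    by (simp_all add: G_def delete_vertex_def)
  have simple: "simple_graph G"
    using simple_graph_hypercube[of "2 * k"] unfolding simple_graph_def G by blast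
  show "k\<^sup>2 + k - 2 \<le> polychromatic_number (delete_vertex (hypercube (2 * k)) v)"
    unfolding G_def[symmetric] by (rule polychromatic_number_bounds(1)[OF k v simple]) (simp_all add: G)
  show "polychromatic_number (delete_vertex (hypercube (2 * k)) v) \<le> k\<^sup>2 + k - 1"
    unfolding G_def[symmetric] by (rule polychromatic_number_bounds(3)[OF k v simple]) (simp_all add: G)
next
  fix k :: nat and e assume k: "k \<ge> 4" and e: "e \<in> edges (hypercube (2 * k))"
  obtain Z p where "e = cedge (2 * k) Z p"
    using e by (rule edge_hypercubeE)
  \<comment> \<open>Deleting an edge leaves intact the cube minus either endpoint of that
    edge.\<close>
  then obtain v where v: "length v = 2 * k" "v \<in> e"
    unfolding cedge_def using length_vec by blast
  have k3: "k \<ge> 3"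
    using k by simp
  define G where "G = delete_edge (hypercube (2 * k)) e"
  have G: "verts G = verts (hypercube (2 * k))" "edges G = edges (hypercube (2 * k)) - {e}"
    by (simp_all add: G_def delete_edge_def)
  have simple: "simple_graph G"
    using simple_graph_hypercube[of "2 * k"] unfolding simple_graph_def G by blast
  have keep: "e' \<in> edges G" if "e' \<in> edges (hypercube (2 * k))" "v \<notin> e'" for e'
    using that v(2) by (auto simp: G)
  have sub: "verts (hypercube (2 * k)) - {v} \<subseteq> verts G" "verts G \<subseteq> verts (hypercube (2 * k))"
    "edges G \<subseteq> edges (hypercube (2 * k))"
    by (auto simp: G)
  show "k\<^sup>2 + k - 2 \<le> polychromatic_number (delete_edge (hypercube (2 * k)) e)"
    unfolding G_def[symmetric] by (rule polychromatic_number_bounds(1)[OF k3 v(1) simple sub(1,2) keep sub(3)])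
  show "polychromatic_number (delete_edge (hypercube (2 * k)) e) \<le> k\<^sup>2 + k"
    unfolding G_def[symmetric] by (rule polychromatic_number_bounds(2)[OF k3 v(1) simple sub(1,2) keep sub(3)])
qed

end
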